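(* Let $d_1,d_2,d_3\ge 2$ and let $\rho=\rho_{d_1\otimes d_2\otimes d_3}$ be any (normalized) mixed state on $H_1\otimes H_2\otimes H_3$ with $\dim H_i=d_i$. Then $$C_3(\rho)\;\ge\;\frac{1}{\sqrt{(d_1-1)(d_2-1)(d_3-1)}}\Big[\sum_{\rho_{2\otimes2\otimes2}}\ \sum_{m=1}^{2}\sum_{n=m+1}^{3} C_{mn}^2(\rho_{2\otimes 2\otimes 2})\Big]^{1/2},$$ where the outer sum runs over all $\binom{d_1}{2}\binom{d_2}{2}\binom{d_3}{2}$ possible $2\otimes2\otimes2$ substates $\rho_{2\otimes2\otimes2}$ of $\rho$.
   Context: Each $H_i\cong\mathbb{C}^{d_i}$ has a fixed computational basis $\{|1\rangle,\dots,|d_i\rangle\}$. For a (not necessarily normalized) vector $|\varphi\rangle\in H_1\otimes\cdots\otimes H_N$ with $\sigma=|\varphi\rangle\langle\varphi|$, the $N$-partite concurrence is $C_N(|\varphi\rangle)=2^{1-N/2}\sqrt{(2^N-2)(\mathrm{tr}\,\sigma)^2-\sum_\alpha \mathrm{tr}(\sigma_\alpha^2)}$, where $\alpha$ runs over all $2^N-2$ nonempty proper subsets of $\{1,\dots,N\}$ and $\sigma_\alpha=\mathrm{tr}_{\bar\alpha}\sigma$ is the partial trace over the complement $\bar\alpha$ (for normalized states $\mathrm{tr}\,\sigma=1$). For a (possibly unnormalized) positive semidefinite operator $\sigma$, $C_N(\sigma)=\min\sum_i C_N(|\psi_i\rangle)$, the minimum over all decompositions $\sigma=\sum_i|\psi_i\rangle\langle\psi_i|$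 into (unnormalized) vectors (equivalently the convex roof $\min\sum_ip_iC_N(|\varphi_i\rangle)$ over ensembles $\sigma=\sum_ip_i|\varphi_i\rangle\langle\varphi_i|$). Substates: given subsets $S_i\subseteq\{1,\dots,d_i\}$ and projectors $G_i=\sum_{x\in S_i}|x\rangle\langle x|$, the corresponding substate of $\sigma$ is the unnormalized operator $(G_1\otimes\cdots\otimes G_N)\sigma(G_1\otimes\cdots\otimes G_N)$ regarded as an operator on $\bigotimes_i\mathrm{span}\{|x\rangle:x\in S_i\}$; a $2\otimes2\otimes2$ substate is one with $|S_1|=|S_2|=|S_3|=2$. For an (unnormalized) three-qubit operator $\tau$, $C_{mn}(\tau)$ denotes the Wootters concurrence of the two-qubit reduced operator $\tau_{mn}$ (partial trace over the remaining qubit): $C(\omega)=\max\{0,\lambda_1-\lambda_2-\lambda_3-\lambda_4\}$ where $\lambda_1\ge\dots\ge\lambda_4$ are the square roots of the eigenvalues of $\omega(\sigma_y\otimes\sigma_y)\omega^*(\sigma_y\otimes\sigma_y)$, $\omega^*$ the complex conjugate in the computational basis. *)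

theory Defs
  imports Complex_Main "Jordan_Normal_Form.Char_Poly"
begin

text \<open>Parties are labelled 1..N, party k has local dimension d k, computational
  basis indices 0..<d k.  A basis vector of the composite system restricted to a set
  of parties S is a configuration: a function i with i k < d k for k in S and
  i k = 0 outside S.  Vectors are functions cfg => complex, operators are
  functions cfg => cfg => complex (matrix entries in the computational basis).\<close>

definition cfg :: "(nat \<Rightarrow> nat) \<Rightarrow> nat set \<Rightarrow> (nat \<Rightarrow> nat) set" where
  "cfg d S = {i. (\<forall>k\<in>S. i k < d k) \<and> (\<forall>k. k \<notin> S \<longrightarrow> i k = 0)}"

definition merge :: "nat set \<Rightarrow> (nat \<Rightarrow> nat) \<Rightarrow> (nat \<Rightarrow> nat) \<Rightarrow> (nat \<Rightarrow> nat)" where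
  "merge A x z = (\<lambda>k. if k \<in> A then x k else z k)"

definition ptrace :: "(nat \<Rightarrow> nat) \<Rightarrow> nat \<Rightarrow> nat set
    \<Rightarrow> ((nat \<Rightarrow> nat) \<Rightarrow> (nat \<Rightarrow> nat) \<Rightarrow> complex) \<Rightarrow> (nat \<Rightarrow> nat) \<Rightarrow> (nat \<Rightarrow> nat) \<Rightarrow> complex" where
  "ptrace d N \<alpha> \<sigma> x y = (\<Sum>z\<in>cfg d ({1..N} - \<alpha>). \<sigma> (merge \<alpha> x z) (merge \<alpha> y z))"

definition trace_op :: "(nat \<Rightarrow> nat) \<Rightarrow> nat \<Rightarrow> ((nat \<Rightarrow> nat) \<Rightarrow> (nat \<Rightarrow> nat) \<Rightarrow> complex) \<Rightarrow> complex" where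
  "trace_op d N \<sigma> = (\<Sum>i\<in>cfg d {1..N}. \<sigma> i i)"

definition proj_op :: "((nat \<Rightarrow> nat) \<Rightarrow> complex) \<Rightarrow> (nat \<Rightarrow> nat) \<Rightarrow> (nat \<Rightarrow> nat) \<Rightarrow> complex" where
  "proj_op \<phi> i j = \<phi> i * cnj (\<phi> j)"

definition purity :: "(nat \<Rightarrow> nat) \<Rightarrow> nat \<Rightarrow> nat set
    \<Rightarrow> ((nat \<Rightarrow> nat) \<Rightarrow> (nat \<Rightarrow> nat) \<Rightarrow> complex) \<Rightarrow> complex" where
  "purity d N \<alpha> \<sigma> = (\<Sum>x\<in>cfg d \<alpha>. \<Sum>y\<in>cfg d \<alpha>. ptrace d N \<alpha> \<sigma> x y * ptrace d N \<alpha> \<sigma> y x)"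

definition conc_pure :: "(nat \<Rightarrow> nat) \<Rightarrow> nat \<Rightarrow> ((nat \<Rightarrow> nat) \<Rightarrow> complex) \<Rightarrow> real" where
  "conc_pure d N \<phi> =
     (let \<sigma> = proj_op \<phi> in
      2 powr (1 - real N / 2) *
      sqrt ((2 ^ N - 2) * (Re (trace_op d N \<sigma>))\<^sup>2
            - Re (\<Sum>\<alpha>\<in>{\<alpha>. \<alpha> \<subseteq> {1..N} \<and> \<alpha> \<noteq> {} \<and> \<alpha> \<noteq> {1..N}}. purity d N \<alpha> \<sigma>)))"

definition is_decomp :: "(nat \<Rightarrow> nat) \<Rightarrow> nat \<Rightarrow> ((nat \<Rightarrow> nat) \<Rightarrow> (nat \<Rightarrow> nat) \<Rightarrow> complex)
    \<Rightarrow> ((nat \<Rightarrow> nat) \<Rightarrow> complex) list \<Rightarrow> bool" where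
  "is_decomp d N \<sigma> \<psi>s \<longleftrightarrow>
     (\<forall>i\<in>cfg d {1..N}. \<forall>j\<in>cfg d {1..N}. \<sigma> i j = (\<Sum>\<psi>\<leftarrow>\<psi>s. \<psi> i * cnj (\<psi> j)))"

definition conc_mixed :: "(nat \<Rightarrow> nat) \<Rightarrow> nat \<Rightarrow> ((nat \<Rightarrow> nat) \<Rightarrow> (nat \<Rightarrow> nat) \<Rightarrow> complex) \<Rightarrow> real" where
  "conc_mixed d N \<sigma> = Inf {(\<Sum>\<psi>\<leftarrow>\<psi>s. conc_pure d N \<psi>) | \<psi>s. is_decomp d N \<sigma> \<psi>s}"

definition psd_op :: "(nat \<Rightarrow> nat) \<Rightarrow> nat \<Rightarrow> ((nat \<Rightarrow> nat) \<Rightarrow> (nat \<Rightarrow> nat) \<Rightarrow> complex) \<Rightarrow> bool" where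
  "psd_op d N \<sigma> \<longleftrightarrow> (\<forall>v :: (nat \<Rightarrow> nat) \<Rightarrow> complex.
     let q = (\<Sum>i\<in>cfg d {1..N}. \<Sum>j\<in>cfg d {1..N}. cnj (v i) * \<sigma> i j * v j)
     in Im q = 0 \<and> Re q \<ge> 0)"

definition is_state :: "(nat \<Rightarrow> nat) \<Rightarrow> nat \<Rightarrow> ((nat \<Rightarrow> nat) \<Rightarrow> (nat \<Rightarrow> nat) \<Rightarrow> complex) \<Rightarrow> bool" where
  "is_state d N \<rho> \<longleftrightarrow> psd_op d N \<rho> \<and> trace_op d N \<rho> = 1"

text \<open>Two-qubit operators as 4x4 matrices (index 2*a+b for qubits a,b); Wootters concurrence.\<close>
definition sigma_y :: "nat \<Rightarrow> nat \<Rightarrow> complex" where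
  "sigma_y a b = (if a = 0 \<and> b = 1 then - \<i> else if a = 1 \<and> b = 0 then \<i> else 0)"

definition yy :: "complex mat" where
  "yy = mat 4 4 (\<lambda>(k, l). sigma_y (k div 2) (l div 2) * sigma_y (k mod 2) (l mod 2))"

definition wootters_ls :: "complex mat \<Rightarrow> real list" where
  "wootters_ls \<omega> = (SOME ls. length ls = 4 \<and> sorted (rev ls) \<and> (\<forall>l\<in>set ls. l \<ge> 0) \<and>
      char_poly (\<omega> * yy * map_mat cnj \<omega> * yy) = (\<Prod>l\<leftarrow>ls. [:- complex_of_real (l\<^sup>2), 1:]))"

definition wootters :: "complex mat \<Rightarrow> real" where
  "wootters \<omega> = (let ls = wootters_ls \<omega> in max 0 (ls ! 0 - ls ! 1 - ls ! 2 - ls ! 3))"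

definition qubits :: "nat \<Rightarrow> nat" where "qubits = (\<lambda>_. 2)"

definition red2 :: "nat \<Rightarrow> nat \<Rightarrow> ((nat \<Rightarrow> nat) \<Rightarrow> (nat \<Rightarrow> nat) \<Rightarrow> complex) \<Rightarrow> complex mat" where
  "red2 m n \<tau> = mat 4 4 (\<lambda>(k, l).
      ptrace qubits 3 {m, n} \<tau>
        ((\<lambda>_. 0)(m := k div 2, n := k mod 2)) ((\<lambda>_. 0)(m := l div 2, n := l mod 2)))"

definition Cmn :: "nat \<Rightarrow> nat \<Rightarrow> ((nat \<Rightarrow> nat) \<Rightarrow> (nat \<Rightarrow> nat) \<Rightarrow> complex) \<Rightarrow> real" where
  "Cmn m n \<tau> = wootters (red2 m n \<tau>)"

text \<open>Substate: S k is a 2-element subset of {0..<d k}; the qubit basis |0>,|1> of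
  party k is identified with the smaller/larger element of S k.\<close>
definition substate :: "(nat \<Rightarrow> nat set) \<Rightarrow> ((nat \<Rightarrow> nat) \<Rightarrow> (nat \<Rightarrow> nat) \<Rightarrow> complex)
    \<Rightarrow> (nat \<Rightarrow> nat) \<Rightarrow> (nat \<Rightarrow> nat) \<Rightarrow> complex" where
  "substate S \<rho> a b =
     \<rho> (\<lambda>k. if k \<in> {1,2,3} then sorted_list_of_set (S k) ! a k else 0)
       (\<lambda>k. if k \<in> {1,2,3} then sorted_list_of_set (S k) ! b k else 0)"

definition substate_choices :: "(nat \<Rightarrow> nat) \<Rightarrow> (nat \<Rightarrow> nat set) set" where
  "substate_choices d = {S. (\<forall>k\<in>{1,2,3::nat}. S k \<subseteq> {0..<d k} \<and> card (S k) = 2) \<and>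
                            (\<forall>k. k \<notin> {1,2,3} \<longrightarrow> S k = {})}"

end

theory Submission
  imports Defs "Jordan_Normal_Form.Schur_Decomposition" "HOL-Analysis.L2_Norm"
begin

text \<open>Write \<open>\<omega> = W W\<^sup>\<dagger>\<close> with one column of \<open>W\<close> for each vector of an ensemble and each basis state of the
  traced-out qubit, and let \<open>Y = \<sigma>\<^sub>y \<otimes> \<sigma>\<^sub>y\<close>. The numbers in Wootters' formula are the singular values of the
  symmetric matrix \<open>T = W\<^sup>T Y W\<close>, and a Takagi factorisation of \<open>T\<close> shows that
  \<open>\<lambda>\<^sub>1 - \<lambda>\<^sub>2 - \<lambda>\<^sub>3 - \<lambda>\<^sub>4\<close> is at most the sum of the Frobenius norms of the diagonal blocks of \<open>T\<close> that belong to the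
  individual ensemble vectors. For a pure three-qubit vector the squares of these norms, summed over the
  three pairs of qubits, give exactly the squared concurrence, which is half the sum of the squared moduli of
  all 2x2 minors across the three bipartitions. A minor of the full vector occurs in at most
  \<open>(d\<^sub>1 - 1) (d\<^sub>2 - 1) (d\<^sub>3 - 1)\<close> substates, which gives the bound for pure states; Minkowski's inequality
  carries it over to ensembles.\<close>

section \<open>Characteristic polynomials and Takagi factorisation\<close>

text \<open>Sylvester's identity: the determinant of the block matrix with rows (X I, A) and (B, I)
  is computed in two ways. The powers of X make up for the different sizes of \<open>A * B\<close>
  and \<open>B * A\<close>.\<close>

lemma char_poly_mult_swap:
  fixes A B :: "complex mat"
  assumes A: "A \<in> carrier_mat n m" and B: "B \<in> carrier_mat m n"
  shows "[:0, 1:] ^ m * char_poly (A * B) = [:0, 1:] ^ n * char_poly (B * A)"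
proof -
  let ?X = "[:0, 1:] :: complex poly"
  let ?c = "map_mat (\<lambda>a. [:a:])"
  interpret h: comm_ring_hom "\<lambda>a::complex. [:a:]"
    by unfold_locales (auto simp: one_pCons)
  define PA where "PA = ?c A"
  define PB where "PB = ?c B"
  have PA: "PA \<in> carrier_mat n m" and PB: "PB \<in> carrier_mat m n"
    using A B by (auto simp: PA_def PB_def)
  have cAB: "char_poly (A * B) = det (?X \<cdot>\<^sub>m 1\<^sub>m n - PA * PB)"
  proof -
    have "char_poly_matrix (A * B) = ?X \<cdot>\<^sub>m 1\<^sub>m n - PA * PB"
      unfolding PA_def PB_def h.mat_hom_mult[OF A B, symmetric]
      by (rule eq_matI, insert A B, auto simp: char_poly_matrix_def)
    then show ?thesis by (simp add: char_poly_def)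
  qed
  have cBA: "char_poly (B * A) = det (?X \<cdot>\<^sub>m 1\<^sub>m m - PB * PA)"
  proof -
    have "char_poly_matrix (B * A) = ?X \<cdot>\<^sub>m 1\<^sub>m m - PB * PA"
      unfolding PA_def PB_def h.mat_hom_mult[OF B A, symmetric]
      by (rule eq_matI, insert A B, auto simp: char_poly_matrix_def)
    then show ?thesis by (simp add: char_poly_def)
  qed
  \<comment> \<open>Both \<open>L\<close> on the right and \<open>K\<close> on the left clear the
    lower left block of \<open>M\<close>. The first leaves X I - A B in the upper left corner at no
    cost, the second leaves X I - B A in the lower right corner at the cost of the factor
    \<open>det K\<close>.\<close>
  define M where "M = four_block_mat (?X \<cdot>\<^sub>m 1\<^sub>m n) PA PB (1\<^sub>m m)"
  define L where "L = four_block_mat (1\<^sub>m n) (0\<^sub>m n m) (- PB) (1\<^sub>m m)"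
  define K where "K = four_block_mat (1\<^sub>m n) (0\<^sub>m n m) (- PB) (?X \<cdot>\<^sub>m 1\<^sub>m m)"
  have M: "M \<in> carrier_mat (n + m) (n + m)" and L: "L \<in> carrier_mat (n + m) (n + m)"
    and K: "K \<in> carrier_mat (n + m) (n + m)"
    using PA PB by (auto simp: M_def L_def K_def)
  have dL: "det L = 1" unfolding L_def
    by (subst det_four_block_mat_upper_right_zero[where n=n and m=m], insert PB, auto)
  have dK: "det K = ?X ^ m" unfolding K_def
    by (subst det_four_block_mat_upper_right_zero[where n=n and m=m], insert PB, auto simp: det_smult)
  have "M * L = four_block_mat (?X \<cdot>\<^sub>m 1\<^sub>m n - PA * PB) PA (0\<^sub>m m n) (1\<^sub>m m)"
    unfolding M_def L_def
    apply (subst mult_four_block_mat[where ?n1.0=n and ?n2.0=m and ?nr1.0=n and ?nr2.0=m and ?nc1.0=n and ?nc2.0=m])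
    using PA PB by (auto intro!: eq_matI cong_four_block_mat)
  moreover have "det (four_block_mat (?X \<cdot>\<^sub>m 1\<^sub>m n - PA * PB) PA (0\<^sub>m m n) (1\<^sub>m m))
      = char_poly (A * B)"
    by (subst det_four_block_mat_lower_left_zero[where n=n and m=m], insert PA PB, auto simp: cAB)
  ultimately have 1: "det M = char_poly (A * B)"
    using det_mult[OF M L] dL by simp
  have "K * M = four_block_mat (?X \<cdot>\<^sub>m 1\<^sub>m n) PA (0\<^sub>m m n) (?X \<cdot>\<^sub>m 1\<^sub>m m - PB * PA)"
    unfolding M_def K_def
    apply (subst mult_four_block_mat[where ?n1.0=n and ?n2.0=m and ?nr1.0=n and ?nr2.0=m and ?nc1.0=n and ?nc2.0=m])
    using PA PB by (auto intro!: eq_matI cong_four_block_mat)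

  moreover have "det (four_block_mat (?X \<cdot>\<^sub>m 1\<^sub>m n) PA (0\<^sub>m m n) (?X \<cdot>\<^sub>m 1\<^sub>m m - PB * PA))
      = ?X ^ n * char_poly (B * A)"
    by (subst det_four_block_mat_lower_left_zero[where n=n and m=m], insert PA PB,
        auto simp: det_smult cBA)
  ultimately have "?X ^ m * det M = ?X ^ n * char_poly (B * A)"
    using det_mult[OF K M] dK by simp
  with 1 show ?thesis by simp
qed

text \<open>The trace is invariant under similarity, and in a Schur form it is the sum of the
  eigenvalues, so these cannot all vanish.\<close>

lemma exists_nonzero_eigenvalue:
  fixes A :: "complex mat"
  assumes A: "A \<in> carrier_mat n n" and tr: "(\<Sum>i<n. A $$ (i, i)) \<noteq> 0"
  shows "\<exists>k. k \<noteq> 0 \<and> eigenvalue A k"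
proof -
  obtain as where cp: "char_poly A = (\<Prod>a\<leftarrow>as. [:- a, 1:])"
    using char_poly_factorized[OF A] by auto
  obtain B P Q where dec: "schur_decomposition A as = (B, P, Q)"
    by (cases "schur_decomposition A as")
  from schur_decomposition[OF A cp dec]
  have sim: "similar_mat_wit A B P Q" and diag: "diag_mat B = as" by auto
  from similar_mat_witD2[OF A sim]
  have PQ: "Q * P = 1\<^sub>m n" "A = P * B * Q" "B \<in> carrier_mat n n" "P \<in> carrier_mat n n" "Q \<in> carrier_mat n n"
    by auto
  have tr_swap: "(\<Sum>i<n. (C * D) $$ (i, i)) = (\<Sum>i<n. (D * C) $$ (i, i))"
    if "C \<in> carrier_mat n n" "D \<in> carrier_mat n n" for C D :: "complex mat"
  proof -
    have "(\<Sum>i<n. (C * D) $$ (i, i)) = (\<Sum>i<n. \<Sum>j<n. C $$ (i, j) * D $$ (j, i))"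
      using that by (auto simp: scalar_prod_def lessThan_atLeast0)
    also have "\<dots> = (\<Sum>j<n. \<Sum>i<n. C $$ (i, j) * D $$ (j, i))"
      by (rule sum.swap)
    also have "\<dots> = (\<Sum>j<n. (D * C) $$ (j, j))"
      using that by (auto simp: scalar_prod_def lessThan_atLeast0 mult.commute)
    finally show ?thesis .
  qed
  have "(\<Sum>i<n. A $$ (i, i)) = (\<Sum>i<n. (Q * (P * B)) $$ (i, i))"
    unfolding PQ(2) using PQ by (intro tr_swap) auto
  also have "Q * (P * B) = B"
    using PQ by (simp add: assoc_mult_mat[symmetric, of Q n n P n B n])
  finally have "(\<Sum>i<n. B $$ (i, i)) \<noteq> 0" using tr by simp
  then obtain i where i: "i < n" "B $$ (i, i) \<noteq> 0"
    by (metis (no_types, lifting) lessThan_iff sum.neutral)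
  then have "B $$ (i, i) \<in> set as"
    unfolding diag[symmetric] diag_mat_def using PQ(3) by auto
  then have "poly (char_poly A) (B $$ (i, i)) = 0"
    unfolding cp by (auto simp: poly_prod_list prod_list_zero_iff)
  then show ?thesis using i eigenvalue_root_char_poly[OF A] by auto
qed

text \<open>Orthonormality says that an m by n matrix times its adjoint is the identity, whose
  characteristic polynomial does not vanish at 0. Comparing the order of the root 0 on both sides of
  \<open>char_poly_mult_swap\<close> gives the bound, which makes the deflation in
  \<open>takagi\<close> stop.\<close>

lemma orthonormal_length_le:
  fixes u :: "nat \<Rightarrow> nat \<Rightarrow> complex"
  assumes orth: "\<And>j k. j < m \<Longrightarrow> k < m \<Longrightarrow> (\<Sum>a<n. u j a * cnj (u k a)) = (if j = k then 1 else 0)"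
  shows "m \<le> n"
proof -
  define A where "A = mat m n (\<lambda>(j, a). u j a)"
  define B where "B = mat n m (\<lambda>(a, k). cnj (u k a))"
  have A: "A \<in> carrier_mat m n" and B: "B \<in> carrier_mat n m" by (auto simp: A_def B_def)
  have AB: "A * B = 1\<^sub>m m"
    by (rule eq_matI) (auto simp: A_def B_def scalar_prod_def orth lessThan_atLeast0[symmetric])
  have "\<not> eigenvalue (1\<^sub>m m :: complex mat) 0"
    unfolding eigenvalue_def eigenvector_def
    by (auto simp: vec_eq_iff)
  then have "poly (char_poly (1\<^sub>m m :: complex mat)) 0 \<noteq> 0"
    by (subst (asm) eigenvalue_root_char_poly) auto
  then have ord: "Polynomial.order 0 (char_poly (A * B)) = 0"
    unfolding AB by (simp add: order_root)
  have cp: "[:0, 1:] ^ n * char_poly (A * B) = [:0, 1:] ^ m * char_poly (B * A)"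
    using char_poly_mult_swap[OF A B] .
  have ordX: "Polynomial.order 0 ([:0, 1:] ^ k :: complex poly) = k" for k
    using order_power_n_n[of "0::complex" k] by simp
  have nz: "[:0, 1:] ^ n * char_poly (A * B) \<noteq> 0"
    using degree_monic_char_poly[of "A * B" m] AB by auto
  have "n = Polynomial.order 0 ([:0, 1:] ^ n * char_poly (A * B))"
    using nz by (subst order_mult) (auto simp: ord ordX)
  also have "\<dots> = m + Polynomial.order 0 (char_poly (B * A))"
    unfolding cp using nz[unfolded cp] by (subst order_mult) (auto simp: ordX)
  finally show ?thesis by simp
qed

text \<open>The antilinear map \<open>J\<close>, which sends \<open>f\<close> to \<open>T\<close>
  applied to the conjugate of \<open>f\<close>, has the linear square \<open>H\<close>. By symmetry
  of \<open>T\<close> this is T times its adjoint, so it has a positive eigenvalue, and an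
  eigenvector of \<open>H\<close> is then corrected to one of \<open>J\<close>.\<close>

lemma symmetric_coneigenvector:
  fixes T :: "nat \<Rightarrow> nat \<Rightarrow> complex"
  assumes sym: "\<And>a b. a < n \<Longrightarrow> b < n \<Longrightarrow> T a b = T b a"
    and nz: "p < n" "q < n" "T p q \<noteq> 0"
  shows "\<exists>(l::real) (u :: nat \<Rightarrow> complex). l > (0::real) \<and> (\<Sum>a<n. u a * cnj (u a)) = 1 \<and>
           (\<forall>a<n. (\<Sum>b<n. T a b * cnj (u b)) = l * u a)"
proof -
  define H where "H = mat n n (\<lambda>(a, b). \<Sum>c<n. T a c * cnj (T c b))"
  have H: "H \<in> carrier_mat n n" by (simp add: H_def)
  \<comment> \<open>By symmetry the trace of \<open>H\<close> is the squared Frobenius norm of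
    \<open>T\<close>, which the entry at \<open>p\<close>, \<open>q\<close> makes positive.\<close>
  have "(\<Sum>a<n. H $$ (a, a)) = (\<Sum>a<n. \<Sum>c<n. complex_of_real ((cmod (T a c))\<^sup>2))"
    unfolding H_def using sym
    by (intro sum.cong refl) (auto simp: complex_norm_square simp del: of_real_power intro!: sum.cong)
  also have "\<dots> = complex_of_real (\<Sum>a<n. \<Sum>c<n. (cmod (T a c))\<^sup>2)" by simp
  also have "(\<Sum>a<n. \<Sum>c<n. (cmod (T a c))\<^sup>2) > 0"
  proof (rule sum_pos2[of _ p])
    show "0 < (\<Sum>c<n. (cmod (T p c))\<^sup>2)" by (rule sum_pos2[of _ q]) (use nz in auto)
  qed (use nz in \<open>auto intro: sum_nonneg\<close>)
  then have "complex_of_real (\<Sum>a<n. \<Sum>c<n. (cmod (T a c))\<^sup>2) \<noteq> 0"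
    by (metis less_irrefl of_real_eq_0_iff)
  finally obtain k where k: "k \<noteq> 0" "eigenvalue H k"
    using exists_nonzero_eigenvalue[OF H] by auto
  then obtain v where v: "v \<in> carrier_vec n" "v \<noteq> 0\<^sub>v n" "H *\<^sub>v v = k \<cdot>\<^sub>v v"
    using H by (auto simp: eigenvalue_def eigenvector_def)
  define x where "x = (\<lambda>i. v $ i)"
  define J where "J = (\<lambda>f a. \<Sum>b<n. T a b * cnj (f b))"
  have J_def': "J f a = (\<Sum>b<n. T a b * cnj (f b))" for f a by (simp add: J_def)
  have Hx: "(\<Sum>b<n. (\<Sum>c<n. T a c * cnj (T c b)) * x b) = k * x a" if "a < n" for a
    using arg_cong[OF v(3), of "\<lambda>w. w $ a"] that v(1) H
    by (auto simp: x_def H_def scalar_prod_def lessThan_atLeast0)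
  have JJ: "J (J x) a = k * x a" if "a < n" for a
  proof -
    have "J (J x) a = (\<Sum>c<n. \<Sum>b<n. T a c * cnj (T c b) * x b)"
      by (simp add: J_def sum_distrib_left mult.assoc)
    also have "\<dots> = (\<Sum>b<n. \<Sum>c<n. T a c * cnj (T c b) * x b)" by (rule sum.swap)
    also have "\<dots> = k * x a" using Hx[OF that] by (simp add: sum_distrib_right)
    finally show ?thesis .
  qed
  define nx where "nx = (\<lambda>f :: nat \<Rightarrow> complex. \<Sum>a<n. (cmod (f a))\<^sup>2)"
  have nx_pos: "nx f > 0" if "a < n" "f a \<noteq> 0" for f a
    unfolding nx_def by (rule sum_pos2[of _ a]) (use that in auto)
  obtain i where i: "i < n" "x i \<noteq> 0"
    using v(1,2) unfolding x_def by (metis carrier_vecD eq_vecI index_zero_vec)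
  \<comment> \<open>Symmetry of \<open>T\<close> moves \<open>J\<close> across the inner product.
    This identifies k |x|^2 with |J x|^2, so the eigenvalue is real and nonnegative.\<close>
  have "k * complex_of_real (nx x) = (\<Sum>a<n. J (J x) a * cnj (x a))"
    using JJ by (auto simp: nx_def sum_distrib_left complex_norm_square mult.assoc simp del: of_real_power)
  also have "\<dots> = (\<Sum>a<n. \<Sum>b<n. T a b * cnj (J x b) * cnj (x a))"
    unfolding J_def'[of "J x"] by (simp add: sum_distrib_right)
  also have "\<dots> = (\<Sum>b<n. \<Sum>a<n. T a b * cnj (J x b) * cnj (x a))" by (rule sum.swap)
  also have "\<dots> = (\<Sum>b<n. J x b * cnj (J x b))"
    unfolding J_def'[of x] sum_distrib_right
    by (intro sum.cong refl) (auto simp: sym mult.assoc mult.commute)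
  also have "\<dots> = complex_of_real (nx (J x))"
    by (simp add: nx_def complex_norm_square del: of_real_power)
  finally have kn: "k * complex_of_real (nx x) = complex_of_real (nx (J x))" .
  define r where "r = nx (J x) / nx x"
  have kr: "k = complex_of_real r"
    using kn nx_pos[of i x] i unfolding r_def by (auto simp: field_simps)
  have "r \<ge> 0" unfolding r_def nx_def by (auto intro!: divide_nonneg_nonneg sum_nonneg)
  with kr k(1) have r: "r > 0" by (cases "r = 0") auto
  define l where "l = sqrt r"
  have l: "l > 0" and kl: "k = complex_of_real l * complex_of_real l"
    using r kr by (auto simp: l_def simp flip: of_real_mult)
  have J_add: "J (\<lambda>b. f b + g b) a = J f a + J g a" for f g a
    by (simp add: J_def distrib_left sum.distrib)
  have J_scale: "J (\<lambda>b. c * f b) a = cnj c * J f a" for c f a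
    by (simp add: J_def sum_distrib_left mult_ac)
  \<comment> \<open>Since \<open>J (J x) = l * l * x\<close>, the vector \<open>J x + l * x\<close>
    satisfies the equation, unless it vanishes. Then \<open>J x = - l * x\<close>, and multiplying
    \<open>x\<close> by the imaginary unit flips the sign because \<open>J\<close> is
    antilinear.\<close>
  obtain y where y: "\<And>a. a < n \<Longrightarrow> J y a = complex_of_real l * y a" "\<exists>a<n. y a \<noteq> 0"
  proof (cases "\<exists>a<n. J x a + complex_of_real l * x a \<noteq> 0")
    case True
    show ?thesis
      by (rule that[of "\<lambda>a. J x a + complex_of_real l * x a"])
        (use True in \<open>auto simp: J_add J_scale JJ kl distrib_left\<close>)
  next
    case False
    then have "J x a = - complex_of_real l * x a" if "a < n" for a
      using that by (auto simp: eq_neg_iff_add_eq_0)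
    then show ?thesis
      by (intro that[of "\<lambda>a. \<i> * x a"]) (use i in \<open>auto simp: J_scale\<close>)
  qed
  obtain i' where i': "i' < n" "y i' \<noteq> 0" using y(2) by auto
  define s where "s = complex_of_real (1 / sqrt (nx y))"
  have ss: "s * s * complex_of_real (nx y) = 1"
    using nx_pos[of i' y] i' unfolding s_def by (simp flip: of_real_mult)
  have cs: "cnj s = s" by (simp add: s_def)
  show ?thesis
  proof (intro exI conjI allI impI)
    show "l > 0" by fact
    have "(\<Sum>a<n. (s * y a) * cnj (s * y a)) = s * s * complex_of_real (nx y)"
      by (simp add: nx_def sum_distrib_left complex_norm_square cs mult_ac del: of_real_power)
    then show "(\<Sum>a<n. (s * y a) * cnj (s * y a)) = 1" using ss by simp
    show "(\<Sum>b<n. T a b * cnj (s * y b)) = l * (s * y a)" if "a < n" for a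
      using J_scale[of s y a] y(1)[OF that] unfolding J_def' cs by (simp add: mult_ac)
  qed
qed

text \<open>Takagi factorisation, with only the nonzero singular values listed; proved by
  deflating one coneigenvector at a time.\<close>
lemma takagi:
  fixes T :: "nat \<Rightarrow> nat \<Rightarrow> complex"
  assumes sym: "\<And>a b. a < n \<Longrightarrow> b < n \<Longrightarrow> T a b = T b a"
  obtains m and u :: "nat \<Rightarrow> nat \<Rightarrow> complex" and l :: "nat \<Rightarrow> real"
  where "\<And>j. j < m \<Longrightarrow> l j > 0"
    and "\<And>j k. j < m \<Longrightarrow> k < m \<Longrightarrow> (\<Sum>a<n. u j a * cnj (u k a)) = (if j = k then 1 else 0)"
    and "\<And>a b. a < n \<Longrightarrow> b < n \<Longrightarrow> T a b = (\<Sum>j<m. l j * u j a * u j b)"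
proof -
  define R where "R = (\<lambda>m (u :: nat \<Rightarrow> nat \<Rightarrow> complex) (l :: nat \<Rightarrow> real) a b. T a b - (\<Sum>j<m. l j * u j a * u j b))"
  \<comment> \<open>\<open>R\<close> is what remains of \<open>T\<close> after \<open>m\<close>
    terms. The last conjunct, that it annihilates the conjugates of all vectors found so far, makes
    the next vector orthogonal to them.\<close>
  define P where "P = (\<lambda>m u l. (\<forall>j<m. l j > 0) \<and>
      (\<forall>j<m. \<forall>k<m. (\<Sum>a<n. u j a * cnj (u k a)) = (if j = k then 1 else 0)) \<and>
      (\<forall>j<m. \<forall>a<n. (\<Sum>b<n. R m u l a b * cnj (u j b)) = 0))"
  have step: "\<exists>u' l'. P (Suc m) u' l'" if P: "P m u l" and nz: "\<exists>a<n. \<exists>b<n. R m u l a b \<noteq> 0" for m u l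
  proof -
    let ?R = "R m u l"
    have symR: "?R a b = ?R b a" if "a < n" "b < n" for a b
      using sym[OF that] by (simp add: R_def mult_ac)
    from nz obtain p q where pq: "p < n" "q < n" "?R p q \<noteq> 0" by auto
    obtain \<mu> :: real and w :: "nat \<Rightarrow> complex" where \<mu>: "\<mu> > 0" and w1: "(\<Sum>a<n. w a * cnj (w a)) = 1"
      and Rw: "\<And>a. a < n \<Longrightarrow> (\<Sum>b<n. ?R a b * cnj (w b)) = \<mu> * w a"
      using symmetric_coneigenvector[OF symR pq] by auto
    have ker: "(\<Sum>b<n. ?R a b * cnj (u j b)) = 0" if "j < m" "a < n" for j a
      using P that by (auto simp: P_def)
    \<comment> \<open>Symmetry transfers the residual from the conjugate of \<open>w\<close> to that
      of \<open>u j\<close>, where it gives 0; the factor \<mu> is nonzero.\<close>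
    have wu: "(\<Sum>a<n. w a * cnj (u j a)) = 0" if j: "j < m" for j
    proof -
      have "\<mu> * (\<Sum>a<n. w a * cnj (u j a)) = (\<Sum>a<n. (\<Sum>b<n. ?R a b * cnj (w b)) * cnj (u j a))"
        unfolding sum_distrib_left by (intro sum.cong refl) (simp add: Rw mult.assoc)
      also have "\<dots> = (\<Sum>a<n. \<Sum>b<n. ?R a b * cnj (w b) * cnj (u j a))"
        by (simp add: sum_distrib_right)
      also have "\<dots> = (\<Sum>b<n. \<Sum>a<n. ?R a b * cnj (w b) * cnj (u j a))" by (rule sum.swap)
      also have "\<dots> = (\<Sum>b<n. cnj (w b) * (\<Sum>a<n. ?R b a * cnj (u j a)))"
        unfolding sum_distrib_left using symR by (intro sum.cong refl) (auto simp: mult_ac)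
      also have "\<dots> = 0" using ker[OF j] by simp
      finally show ?thesis using \<mu> by simp
    qed
    have uw: "(\<Sum>a<n. u j a * cnj (w a)) = 0" if j: "j < m" for j
    proof -
      have "cnj (\<Sum>a<n. w a * cnj (u j a)) = 0" using wu[OF j] by simp
      then show ?thesis by (simp add: mult.commute)
    qed
    define u' where "u' = u(m := w)"
    define l' where "l' = l(m := \<mu>)"
    have old: "u' j = u j" "l' j = l j" if "j < m" for j using that by (auto simp: u'_def l'_def)
    have new: "u' m = w" "l' m = \<mu>" by (auto simp: u'_def l'_def)
    have R': "R (Suc m) u' l' a b = ?R a b - \<mu> * w a * w b" for a b
      by (simp add: R_def old new)
    have R'sum: "(\<Sum>b<n. R (Suc m) u' l' a b * cnj (f b)) =
        (\<Sum>b<n. ?R a b * cnj (f b)) - \<mu> * w a * (\<Sum>b<n. w b * cnj (f b))" for a f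
      by (simp add: R' left_diff_distrib sum_subtractf sum_distrib_left mult.assoc)
    have "P (Suc m) u' l'"
      unfolding P_def
    proof (intro conjI allI impI)
      fix j assume "j < Suc m"
      then show "l' j > 0" using P \<mu> by (auto simp: P_def l'_def)
    next
      fix j k assume "j < Suc m" "k < Suc m"
      then show "(\<Sum>a<n. u' j a * cnj (u' k a)) = (if j = k then 1 else 0)"
        using P by (auto simp: less_Suc_eq old new wu uw w1 P_def)
    next
      fix j a assume "j < Suc m" "a < n"
      then show "(\<Sum>b<n. R (Suc m) u' l' a b * cnj (u' j b)) = 0"
        by (auto simp: less_Suc_eq old new R'sum ker wu w1 Rw)
    qed
    then show ?thesis by blast
  qed
  \<comment> \<open>If the residual never vanished, deflation would produce n + 1 orthonormal
    vectors in dimension n.\<close>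
  have "\<exists>m u l. P m u l \<and> \<not> (\<exists>a<n. \<exists>b<n. R m u l a b \<noteq> 0)"
  proof (rule ccontr)
    assume no: "\<not> ?thesis"
    have ex: "\<exists>u l. P m u l" for m
    proof (induction m)
      case 0
      show ?case by (auto simp: P_def)
    next
      case (Suc m)
      then obtain u l where P: "P m u l" by blast
      with no have "\<exists>a<n. \<exists>b<n. R m u l a b \<noteq> 0" by blast
      from step[OF P this] show ?case .
    qed
    from ex[of "Suc n"] obtain u l where "P (Suc n) u l" by blast
    then have "Suc n \<le> n" by (intro orthonormal_length_le[where u=u and n=n]) (auto simp: P_def)
    then show False by simp
  qed
  then obtain m u l where "P m u l" "\<not> (\<exists>a<n. \<exists>b<n. R m u l a b \<noteq> 0)" by blast
  then show ?thesis by (intro that[of m l u]) (auto simp: P_def R_def)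
qed

section \<open>Wootters concurrence of an ensemble\<close>

lemma L2_set_sum_le: "L2_set (\<lambda>x. \<Sum>i\<in>I. f i x) A \<le> (\<Sum>i\<in>I. L2_set (f i) A)"
proof (induction I rule: infinite_finite_induct)
  case (insert i I)
  then show ?case
    using L2_set_triangle_ineq[of "f i" "\<lambda>x. \<Sum>i\<in>I. f i x" A] by simp
qed (auto simp: L2_set_def)

lemma L2_set_rank_one:
  fixes v :: "'a \<Rightarrow> complex"
  assumes "c \<ge> 0"
  shows "L2_set (\<lambda>(a, b). cmod (complex_of_real c * v a * v b)) (B \<times> B) = c * (\<Sum>a\<in>B. (cmod (v a))\<^sup>2)"
proof -
  have "(\<Sum>p\<in>B \<times> B. (case p of (a, b) \<Rightarrow> cmod (complex_of_real c * v a * v b))\<^sup>2)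
      = (c * (\<Sum>a\<in>B. (cmod (v a))\<^sup>2))\<^sup>2"
  proof -
    have "(\<Sum>p\<in>B \<times> B. (case p of (a, b) \<Rightarrow> cmod (complex_of_real c * v a * v b))\<^sup>2)
        = (\<Sum>(a, b)\<in>B \<times> B. c\<^sup>2 * ((cmod (v a))\<^sup>2 * (cmod (v b))\<^sup>2))"
      using assms by (intro sum.cong refl) (auto simp: norm_mult power_mult_distrib)
    also have "\<dots> = c\<^sup>2 * ((\<Sum>a\<in>B. (cmod (v a))\<^sup>2) * (\<Sum>b\<in>B. (cmod (v b))\<^sup>2))"
      by (simp only: sum_product sum.cartesian_product[symmetric]) (simp add: sum_distrib_left)
    finally show ?thesis by (simp add: power_mult_distrib power2_eq_square[of "sum _ _"])
  qed
  then show ?thesis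
    using assms by (simp add: L2_set_def sum_nonneg)
qed

text \<open>If \<open>T = U L U\<^sup>T\<close> with isometric \<open>U\<close>, each diagonal block of \<open>T\<close> has Frobenius norm at least
  \<open>l\<^sub>q |u\<^sub>q|\<^sup>2 - (\<Sum>j\<noteq>q. l\<^sub>j |u\<^sub>j|\<^sup>2)\<close> with the norms taken over the block; these bounds add up.\<close>
lemma diagonal_blocks_bound:
  fixes T :: "nat \<Rightarrow> nat \<Rightarrow> complex" and u :: "nat \<Rightarrow> nat \<Rightarrow> complex" and l :: "nat \<Rightarrow> real"
  assumes l: "\<And>j. j < m \<Longrightarrow> l j > 0"
    and orth: "\<And>j. j < m \<Longrightarrow> (\<Sum>a<n. u j a * cnj (u j a)) = 1"
    and T: "\<And>a b. a < n \<Longrightarrow> b < n \<Longrightarrow> T a b = (\<Sum>j<m. l j * u j a * u j b)"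
    and B: "finite I" "(\<Union>i\<in>I. B i) = {..<n}" "disjoint_family_on B I"
    and q: "q < m"
  shows "2 * l q - (\<Sum>j<m. l j) \<le> (\<Sum>i\<in>I. L2_set (\<lambda>(a, b). cmod (T a b)) (B i \<times> B i))"
proof -
  \<comment> \<open>\<open>s j i\<close> is the weight of \<open>u j\<close> on block
    \<open>i\<close>. By \<open>orth\<close> and the partition, the weights of each vector add up to
    1.\<close>
  define s where "s = (\<lambda>j i. \<Sum>a\<in>B i. (cmod (u j a))\<^sup>2)"
  have finB: "finite (B i)" if "i \<in> I" for i
    using B(2) that by (metis UN_upper finite_lessThan finite_subset)
  have s1: "(\<Sum>i\<in>I. s j i) = 1" if "j < m" for j
  proof -
    have "(\<Sum>i\<in>I. s j i) = (\<Sum>a\<in>(\<Union>i\<in>I. B i). (cmod (u j a))\<^sup>2)"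
      unfolding s_def using B finB by (subst sum.UNION_disjoint) (auto simp: disjoint_family_on_def)
    also have "complex_of_real \<dots> = 1"
      unfolding B(2) using orth[OF that] by (simp add: complex_norm_square del: of_real_power)
    finally show ?thesis by (simp only: of_real_eq_1_iff)
  qed
  have blk: "2 * l q * s q i - (\<Sum>j<m. l j * s j i) \<le> L2_set (\<lambda>(a, b). cmod (T a b)) (B i \<times> B i)"
    if i: "i \<in> I" for i
  proof -
    let ?f = "\<lambda>j (a, b). cmod (complex_of_real (l j) * u j a * u j b)"
    have L: "L2_set (?f j) (B i \<times> B i) = l j * s j i" if "j < m" for j
      using L2_set_rank_one[of "l j" "u j" "B i"] l[OF that] by (simp add: s_def)
    \<comment> \<open>The equation for \<open>T\<close> is solved for its term with index
      \<open>q\<close>; the L2 norm of this entrywise triangle inequality over the block gives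
      \<open>blk\<close>.\<close>
    have pt: "?f q p \<le> (case p of (a, b) \<Rightarrow> cmod (T a b)) + (\<Sum>j\<in>{..<m} - {q}. ?f j p)"
      if p: "p \<in> B i \<times> B i" for p
    proof -
      obtain a b where ab: "p = (a, b)" "a < n" "b < n" using p i B(2) by fastforce
      have "complex_of_real (l q) * u q a * u q b
          = T a b - (\<Sum>j\<in>{..<m} - {q}. complex_of_real (l j) * u j a * u j b)"
        using q by (simp add: T[OF ab(2,3)] sum_diff1)
      also have "cmod \<dots> \<le> cmod (T a b) + (\<Sum>j\<in>{..<m} - {q}. cmod (complex_of_real (l j) * u j a * u j b))"
        by (intro order_trans[OF norm_triangle_ineq4] add_left_mono norm_sum)
      finally show ?thesis by (simp add: ab)
    qed
    have "l q * s q i = L2_set (?f q) (B i \<times> B i)" using L[OF q] by simp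
    also have "\<dots> \<le> L2_set (\<lambda>p. (case p of (a, b) \<Rightarrow> cmod (T a b)) + (\<Sum>j\<in>{..<m} - {q}. ?f j p)) (B i \<times> B i)"
      by (rule L2_set_mono[OF pt]) auto
    also have "\<dots> \<le> L2_set (\<lambda>(a, b). cmod (T a b)) (B i \<times> B i)
        + (\<Sum>j\<in>{..<m} - {q}. L2_set (?f j) (B i \<times> B i))"
      by (intro order_trans[OF L2_set_triangle_ineq] add_left_mono L2_set_sum_le)
    also have "(\<Sum>j\<in>{..<m} - {q}. L2_set (?f j) (B i \<times> B i)) = (\<Sum>j\<in>{..<m} - {q}. l j * s j i)"
      by (intro sum.cong refl L) auto
    also have "\<dots> = (\<Sum>j<m. l j * s j i) - l q * s q i"
      using q by (simp add: sum_diff1)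
    finally show ?thesis by simp
  qed
  have "2 * l q - (\<Sum>j<m. l j) = 2 * l q * (\<Sum>i\<in>I. s q i) - (\<Sum>j<m. l j * (\<Sum>i\<in>I. s j i))"
    using s1 q by simp
  also have "\<dots> = (\<Sum>i\<in>I. 2 * l q * s q i - (\<Sum>j<m. l j * s j i))"
    unfolding sum_subtractf sum_distrib_left by (subst sum.swap[of _ I]) simp
  also have "\<dots> \<le> (\<Sum>i\<in>I. L2_set (\<lambda>(a, b). cmod (T a b)) (B i \<times> B i))"
    by (intro sum_mono blk)
  finally show ?thesis .
qed

section \<open>Wootters' numbers from a Takagi factorisation\<close>

text \<open>The bilinear form \<open>x\<^sup>T (\<sigma>\<^sub>y \<otimes> \<sigma>\<^sub>y) y\<close>.\<close>
definition tau :: "(nat \<Rightarrow> complex) \<Rightarrow> (nat \<Rightarrow> complex) \<Rightarrow> complex" where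
  "tau x y = x 1 * y 2 + x 2 * y 1 - x 0 * y 3 - x 3 * y 0"

lemma tau_commute: "tau x y = tau y x"
  by (simp add: tau_def)

lemma yy_index:
  "k < 4 \<Longrightarrow> l < 4 \<Longrightarrow> yy $$ (k, l) = (if k + l = 3 then if k = 0 \<or> k = 3 then -1 else 1 else 0)"
proof -
  assume kl: "k < 4" "l < 4"
  then have "k = 0 \<or> k = 1 \<or> k = 2 \<or> k = 3" "l = 0 \<or> l = 1 \<or> l = 2 \<or> l = 3" by auto
  then show ?thesis
    by (elim disjE; simp add: yy_def sigma_y_def)
qed

lemma yy_dim [simp]: "dim_row yy = 4" "dim_col yy = 4"
  by (simp_all add: yy_def)

lemma sum_upto_4: "(\<Sum>k\<in>{0..<4}. f k) = f 0 + f 1 + f 2 + f (3::nat)"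
  for f :: "nat \<Rightarrow> 'a :: comm_monoid_add"
  by (simp add: numeral_eq_Suc atLeast0_lessThan_Suc add_ac)

lemma yy_form:
  fixes X Z :: "complex mat"
  assumes "X \<in> carrier_mat n 4" "Z \<in> carrier_mat 4 r"
  shows "X * yy * Z = mat n r (\<lambda>(a, b). tau (\<lambda>k. X $$ (a, k)) (\<lambda>k. Z $$ (k, b)))"
proof (rule eq_matI)
  fix a b assume "a < dim_row (mat n r (\<lambda>(a, b). tau (\<lambda>k. X $$ (a, k)) (\<lambda>k. Z $$ (k, b))))"
    "b < dim_col (mat n r (\<lambda>(a, b). tau (\<lambda>k. X $$ (a, k)) (\<lambda>k. Z $$ (k, b))))"
  then have ab: "a < n" "b < r" by auto
  have "(X * yy * Z) $$ (a, b) = (\<Sum>l\<in>{0..<4}. (\<Sum>k\<in>{0..<4}. X $$ (a, k) * yy $$ (k, l)) * Z $$ (l, b))"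
    using assms ab by (auto simp: scalar_prod_def)
  also have "\<dots> = tau (\<lambda>k. X $$ (a, k)) (\<lambda>k. Z $$ (k, b))"
  proof -
    have e: "yy $$ (0, 0) = 0" "yy $$ (0, 1) = 0" "yy $$ (0, 2) = 0" "yy $$ (0, 3) = -1"
      "yy $$ (1, 0) = 0" "yy $$ (1, 1) = 0" "yy $$ (1, 2) = 1" "yy $$ (1, 3) = 0"
      "yy $$ (2, 0) = 0" "yy $$ (2, 1) = 1" "yy $$ (2, 2) = 0" "yy $$ (2, 3) = 0"
      "yy $$ (3, 0) = -1" "yy $$ (3, 1) = 0" "yy $$ (3, 2) = 0" "yy $$ (3, 3) = 0"
      by (simp_all add: yy_index)
    show ?thesis
      unfolding sum_upto_4 e tau_def by (simp only: mult_zero_right add_0_left add_0_right mult_1_right mult_minus_right) (simp add: mult.commute)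
  qed
  finally show "(X * yy * Z) $$ (a, b) = mat n r (\<lambda>(a, b). tau (\<lambda>k. X $$ (a, k)) (\<lambda>k. Z $$ (k, b))) $$ (a, b)"
    using ab by simp
next
  show "dim_row (X * yy * Z) = dim_row (mat n r (\<lambda>(a, b). tau (\<lambda>k. X $$ (a, k)) (\<lambda>k. Z $$ (k, b))))"
    using assms(1) by simp
  show "dim_col (X * yy * Z) = dim_col (mat n r (\<lambda>(a, b). tau (\<lambda>k. X $$ (a, k)) (\<lambda>k. Z $$ (k, b))))"
    using assms(2) by simp
qed

lemma assoc_mult_mat_dim:
  fixes A B C :: "'a :: comm_ring_1 mat"
  assumes "dim_col A = dim_row B" "dim_col B = dim_row C"
  shows "(A * B) * C = A * (B * C)"
  by (rule assoc_mult_mat[of _ "dim_row A" "dim_row B" _ "dim_row C" _ "dim_col C"])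
    (use assms in \<open>auto intro!: carrier_matI\<close>)

text \<open>With \<open>\<omega> = W W\<^sup>\<dagger>\<close> and \<open>W\<^sup>T Y W = U L U\<^sup>T\<close>, the matrix \<open>\<omega> Y \<omega>\<^sup>* Y\<close> is the product of \<open>W U\<^sup>*\<close> and
  \<open>L U\<^sup>\<dagger> W\<^sup>T Y\<close>; in the opposite order these two factors multiply to \<open>L\<^sup>2\<close>.\<close>
lemma char_poly_wootters:
  fixes w :: "nat \<Rightarrow> nat \<Rightarrow> complex" and u :: "nat \<Rightarrow> nat \<Rightarrow> complex" and l :: "nat \<Rightarrow> real" and n :: nat
  defines "\<omega> \<equiv> mat 4 4 (\<lambda>(k, k'). \<Sum>a<n. w a k * cnj (w a k'))"
  assumes orth: "\<And>j k. j < m \<Longrightarrow> k < m \<Longrightarrow> (\<Sum>a<n. u j a * cnj (u k a)) = (if j = k then 1 else 0)"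
    and T: "\<And>a b. a < n \<Longrightarrow> b < n \<Longrightarrow> tau (w a) (w b) = (\<Sum>j<m. l j * u j a * u j b)"
  shows "[:0, 1:] ^ m * char_poly (\<omega> * yy * map_mat cnj \<omega> * yy)
    = [:0, 1:] ^ 4 * (\<Prod>x\<leftarrow>map l [0..<m]. [:- complex_of_real (x\<^sup>2), 1:])"
proof -
  define W where "W = mat 4 n (\<lambda>(k, a). w a k)"
  define Wc where "Wc = mat 4 n (\<lambda>(k, a). cnj (w a k))"
  define Wt where "Wt = mat n 4 (\<lambda>(a, k). w a k)"
  define Wd where "Wd = mat n 4 (\<lambda>(a, k). cnj (w a k))"
  define U where "U = mat n m (\<lambda>(a, j). u j a)"
  define Uc where "Uc = mat n m (\<lambda>(a, j). cnj (u j a))"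
  define Ut where "Ut = mat m n (\<lambda>(j, a). u j a)"
  define Ud where "Ud = mat m n (\<lambda>(j, a). cnj (u j a))"
  define L where "L = mat m m (\<lambda>(i, j). if i = j then complex_of_real (l i) else 0)"
  note defs = W_def Wc_def Wt_def Wd_def U_def Uc_def Ut_def Ud_def L_def
  have dims [simp]:
    "dim_row W = 4" "dim_col W = n" "dim_row Wc = 4" "dim_col Wc = n"
    "dim_row Wt = n" "dim_col Wt = 4" "dim_row Wd = n" "dim_col Wd = 4"
    "dim_row U = n" "dim_col U = m" "dim_row Uc = n" "dim_col Uc = m"
    "dim_row Ut = m" "dim_col Ut = n" "dim_row Ud = m" "dim_col Ud = n"
    "dim_row L = m" "dim_col L = m"
    by (simp_all add: defs)
  have \<omega>: "\<omega> = W * Wd"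
    by (rule eq_matI) (auto simp: \<omega>_def defs scalar_prod_def lessThan_atLeast0)
  have \<omega>c: "map_mat cnj \<omega> = Wc * Wt"
    by (rule eq_matI) (auto simp: \<omega>_def defs scalar_prod_def lessThan_atLeast0)
  have LUt: "L * Ut = mat m n (\<lambda>(j, a). l j * u j a)"
    by (rule eq_matI) (auto simp: defs scalar_prod_def if_distrib[of "\<lambda>x. x * _"] sum.delta cong: if_cong)
  have LUd: "L * Ud = mat m n (\<lambda>(j, a). l j * cnj (u j a))"
    by (rule eq_matI) (auto simp: defs scalar_prod_def if_distrib[of "\<lambda>x. x * _"] sum.delta cong: if_cong)
  have WW: "Wt * (yy * W) = U * (L * Ut)"
  proof -
    have "Wt * yy * W = mat n n (\<lambda>(a, b). tau (w a) (w b))"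
      by (subst yy_form[of _ n _ n]) (auto intro!: eq_matI simp: defs tau_def)
    also have "\<dots> = U * (L * Ut)"
      unfolding LUt by (rule eq_matI) (auto simp: T U_def scalar_prod_def lessThan_atLeast0 mult_ac)
    finally show ?thesis by (simp add: assoc_mult_mat_dim)
  qed
  \<comment> \<open>\<open>tau\<close> has real coefficients and the \<open>l j\<close> are real, so
    conjugating the factorisation only conjugates \<open>u\<close>.\<close>
  have WWc: "Wd * (yy * Wc) = Uc * (L * Ud)"
  proof -
    have "Wd * yy * Wc = mat n n (\<lambda>(a, b). cnj (tau (w a) (w b)))"
      by (subst yy_form[of _ n _ n]) (auto intro!: eq_matI simp: defs tau_def)
    also have "\<dots> = Uc * (L * Ud)"
      unfolding LUd by (rule eq_matI) (auto simp: T Uc_def scalar_prod_def lessThan_atLeast0 mult_ac)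
    finally show ?thesis by (simp add: assoc_mult_mat_dim)
  qed
  have UU: "Ud * U = 1\<^sub>m m"
    by (rule eq_matI) (auto simp: defs scalar_prod_def lessThan_atLeast0[symmetric] orth mult.commute[of "cnj _"])
  have UUt: "Ut * Uc = 1\<^sub>m m"
    by (rule eq_matI) (auto simp: defs scalar_prod_def lessThan_atLeast0[symmetric] orth)
  define P where "P = W * Uc"
  define Q where "Q = L * (Ud * (Wt * yy))"
  have P: "P \<in> carrier_mat 4 m" and Q: "Q \<in> carrier_mat m 4"
    by (auto simp: P_def Q_def intro!: carrier_matI)
  have PQ: "\<omega> * yy * map_mat cnj \<omega> * yy = P * Q"
  proof -
    have "\<omega> * yy * map_mat cnj \<omega> * yy = W * ((Wd * (yy * Wc)) * (Wt * yy))"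
      unfolding \<omega>c unfolding \<omega> by (simp add: assoc_mult_mat_dim)
    also have "\<dots> = P * Q"
      unfolding WWc P_def Q_def by (simp add: assoc_mult_mat_dim)
    finally show ?thesis .
  qed
  have QP: "Q * P = L * L"
  proof -
    have "Q * P = L * (Ud * ((Wt * (yy * W)) * Uc))"
      unfolding P_def Q_def by (simp add: assoc_mult_mat_dim)
    also have "\<dots> = L * ((Ud * U) * (L * (Ut * Uc)))"
      unfolding WW by (simp add: assoc_mult_mat_dim)
    also have "\<dots> = L * L"
      unfolding UU UUt by (simp add: left_mult_one_mat[of _ m m] right_mult_one_mat[of _ m m] carrier_matI)
    finally show ?thesis .
  qed
  have LL: "L * L = mat m m (\<lambda>(i, j). if i = j then complex_of_real ((l i)\<^sup>2) else 0)"
    by (rule eq_matI) (auto simp: defs scalar_prod_def power2_eq_square if_distrib[of "\<lambda>x. x * _"] sum.delta cong: if_cong)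
  have "char_poly (L * L) = (\<Prod>a\<leftarrow>diag_mat (L * L). [:- a, 1:])"
    by (rule char_poly_upper_triangular[of _ m]) (auto simp: LL)
  also have "diag_mat (L * L) = map (\<lambda>i. complex_of_real ((l i)\<^sup>2)) [0..<m]"
    by (auto simp: diag_mat_def LL)
  finally have "char_poly (Q * P) = (\<Prod>x\<leftarrow>map l [0..<m]. [:- complex_of_real (x\<^sup>2), 1:])"
    unfolding QP by (simp add: o_def)
  then show ?thesis
    unfolding PQ using char_poly_mult_swap[OF P Q] by simp
qed

text \<open>The choice in \<open>wootters_ls\<close> is determined as a multiset: the characteristic
  polynomial fixes the squares with multiplicity, and nonnegativity fixes the numbers themselves.
  The zeros pad the positive singular values to four entries.\<close>

lemma wootters_spectrum:
  fixes w :: "nat \<Rightarrow> nat \<Rightarrow> complex" and u :: "nat \<Rightarrow> nat \<Rightarrow> complex" and l :: "nat \<Rightarrow> real" and n :: nat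
  defines "\<omega> \<equiv> mat 4 4 (\<lambda>(k, k'). \<Sum>a<n. w a k * cnj (w a k'))"
  assumes l: "\<And>j. j < m \<Longrightarrow> l j > 0"
    and orth: "\<And>j k. j < m \<Longrightarrow> k < m \<Longrightarrow> (\<Sum>a<n. u j a * cnj (u k a)) = (if j = k then 1 else 0)"
    and T: "\<And>a b. a < n \<Longrightarrow> b < n \<Longrightarrow> tau (w a) (w b) = (\<Sum>j<m. l j * u j a * u j b)"
  shows "m \<le> 4 \<and> length (wootters_ls \<omega>) = 4 \<and>
    mset (wootters_ls \<omega>) = mset (map l [0..<m] @ replicate (4 - m) 0)"
proof -
  let ?R = "\<omega> * yy * map_mat cnj \<omega> * yy"
  let ?X = "[:0, 1:] :: complex poly"
  let ?f = "\<lambda>x::real. [:- complex_of_real (x\<^sup>2), 1:]"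
  let ?p = "\<Prod>x\<leftarrow>map l [0..<m]. ?f x"
  have eq: "?X ^ m * char_poly ?R = ?X ^ 4 * ?p"
    unfolding \<omega>_def using char_poly_wootters[OF orth T] .
  have ordX: "Polynomial.order 0 (?X ^ k) = k" for k
    using order_power_n_n[of "0::complex" k] by simp
  have p0: "poly ?p 0 \<noteq> 0"
    using l by (force simp: poly_prod_list prod_list_zero_iff)
  have nz: "?X ^ 4 * ?p \<noteq> 0" using p0 by auto
  \<comment> \<open>The product over the positive values does not vanish at 0, so the right side of
    \<open>eq\<close> has the root 0 exactly four times, while X^m divides the left side.\<close>
  have "m \<le> Polynomial.order 0 (?X ^ m * char_poly ?R)"
    using nz unfolding eq[symmetric] by (subst order_mult) (auto simp: ordX)
  also have "\<dots> = 4"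
    unfolding eq using nz p0 by (subst order_mult) (auto simp: ordX order_root order_0I)
  finally have m: "m \<le> 4" .
  let ?l0 = "map l [0..<m] @ replicate (4 - m) 0"
  have cp: "char_poly ?R = (\<Prod>x\<leftarrow>?l0. ?f x)"
  proof -
    have "?X ^ m * char_poly ?R = ?X ^ m * (?X ^ (4 - m) * ?p)"
      unfolding eq using m by (simp flip: power_add mult.assoc)
    then show ?thesis by (simp add: mult.commute)
  qed
  \<comment> \<open>A witness is required before anything can be concluded about the list picked by
    \<open>SOME\<close>.\<close>
  have "\<exists>ls. length ls = 4 \<and> sorted (rev ls) \<and> (\<forall>x\<in>set ls. x \<ge> 0) \<and> char_poly ?R = (\<Prod>x\<leftarrow>ls. ?f x)"
  proof (intro exI[of _ "rev (sort ?l0)"] conjI ballI)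
    fix x assume "x \<in> set (rev (sort ?l0))"
    then show "x \<ge> 0" using l by (auto simp: less_imp_le)
  next
    have "mset (map ?f (rev (sort ?l0))) = mset (map ?f ?l0)"
      by (simp only: mset_map mset_rev mset_sort)
    then have "(\<Prod>x\<leftarrow>rev (sort ?l0). ?f x) = (\<Prod>x\<leftarrow>?l0. ?f x)"
      by (metis prod_mset_prod_list)
    with cp show "char_poly ?R = (\<Prod>x\<leftarrow>rev (sort ?l0). ?f x)" by simp
  qed (use m in auto)
  then have ls: "length (wootters_ls \<omega>) = 4" "\<forall>x\<in>set (wootters_ls \<omega>). x \<ge> 0"
     "char_poly ?R = (\<Prod>x\<leftarrow>wootters_ls \<omega>. ?f x)"
    unfolding wootters_ls_def by (rule someI2_ex, blast)+
  have roots: "proots (\<Prod>x\<leftarrow>xs. ?f x) = image_mset (\<lambda>x. complex_of_real (x\<^sup>2)) (mset xs)" for xs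
  proof (induction xs)
    case (Cons x xs)
    have "(\<Prod>x\<leftarrow>xs. ?f x) \<noteq> 0" by (auto simp: prod_list_zero_iff)
    with Cons show ?case by (simp add: proots_mult del: mult_pCons_left)
  qed simp
  have sq: "image_mset (\<lambda>z. sqrt (Re z)) (image_mset (\<lambda>x. complex_of_real (x\<^sup>2)) (mset xs)) = mset xs"
    if "\<forall>x\<in>set xs. x \<ge> 0" for xs :: "real list"
    using that by (induction xs) auto
  have l0: "\<forall>x\<in>set ?l0. x \<ge> 0" using l by (auto simp: less_imp_le)
  have "mset (wootters_ls \<omega>) = mset ?l0"
    using sq[OF ls(2)] sq[OF l0] unfolding roots[symmetric] ls(3)[symmetric] cp[symmetric] by simp
  with m ls(1) show ?thesis by blast
qed

lemma wootters_le:
  fixes w :: "nat \<Rightarrow> nat \<Rightarrow> complex"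
  assumes B: "finite I" "(\<Union>i\<in>I. B i) = {..<n}" "disjoint_family_on B I"
  shows "wootters (mat 4 4 (\<lambda>(k, k'). \<Sum>a<n. w a k * cnj (w a k')))
    \<le> (\<Sum>i\<in>I. L2_set (\<lambda>(a, b). cmod (tau (w a) (w b))) (B i \<times> B i))" (is "wootters ?\<omega> \<le> ?rhs")
proof -
  obtain m and u :: "nat \<Rightarrow> nat \<Rightarrow> complex" and l :: "nat \<Rightarrow> real"
    where l: "\<And>j. j < m \<Longrightarrow> l j > 0"
    and orth: "\<And>j k. j < m \<Longrightarrow> k < m \<Longrightarrow> (\<Sum>a<n. u j a * cnj (u k a)) = (if j = k then 1 else 0)"
    and T: "\<And>a b. a < n \<Longrightarrow> b < n \<Longrightarrow> tau (w a) (w b) = (\<Sum>j<m. l j * u j a * u j b)"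
    by (rule takagi[of n "\<lambda>a b. tau (w a) (w b)"]) (auto simp: tau_commute)
  define ls where "ls = wootters_ls ?\<omega>"
  have len: "length ls = 4" and ms: "mset ls = mset (map l [0..<m] @ replicate (4 - m) 0)"
    using wootters_spectrum[OF l orth T] by (auto simp: ls_def)
  have ls_eq: "ls = [ls ! 0, ls ! 1, ls ! 2, ls ! 3]"
    using len by (intro nth_equalityI) (auto simp: numeral_eq_Suc less_Suc_eq)
  have sl: "sum_list ls = (\<Sum>j<m. l j)"
  proof -
    have "sum_list ls = sum_list (map l [0..<m] @ replicate (4 - m) 0)"
      using ms by (metis sum_mset_sum_list)
    then show ?thesis by (simp add: sum_list_replicate interv_sum_list_conv_sum_set_nat lessThan_atLeast0)
  qed
  \<comment> \<open>Twice the first entry minus the sum of all entries is the form that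
    \<open>diagonal_blocks_bound\<close> estimates; the padding zeros do not change the sum.\<close>
  have sum4: "ls ! 0 - ls ! 1 - ls ! 2 - ls ! 3 = 2 * ls ! 0 - (\<Sum>j<m. l j)"
    unfolding sl[symmetric] by (subst (5) ls_eq) simp
  have nn: "?rhs \<ge> 0" by (auto intro!: sum_nonneg)
  have "ls ! 0 \<in> set ls" using len by auto
  then have "ls ! 0 \<in> set (map l [0..<m] @ replicate (4 - m) 0)" using ms by (metis set_mset_mset)
  \<comment> \<open>The first entry is either a padding zero, where the left side is nonpositive, or
    one of the Takagi values.\<close>
  then consider "ls ! 0 = 0" | q where "q < m" "ls ! 0 = l q"
    by (auto simp: set_replicate_conv_if split: if_splits)
  then have "2 * ls ! 0 - (\<Sum>j<m. l j) \<le> ?rhs"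
  proof cases
    case 1
    have "(\<Sum>j<m. l j) \<ge> 0" using l by (intro sum_nonneg) (auto simp: less_imp_le)
    with 1 nn show ?thesis by simp
  next
    case 2
    then show ?thesis using diagonal_blocks_bound[OF l _ T B 2(1)] orth by simp
  qed
  then show ?thesis using nn unfolding wootters_def Let_def ls_def[symmetric] sum4 by simp
qed

section \<open>Decompositions of positive semidefinite operators\<close>

text \<open>Cholesky factorisation by induction: eliminating the index \<open>x\<close> splits off
  one rank-one term and leaves the Schur complement, again positive semidefinite. It shows that the
  infimum in \<open>conc_mixed\<close> is taken over a nonempty set.\<close>

lemma psd_decomposition:
  fixes \<sigma> :: "'a \<Rightarrow> 'a \<Rightarrow> complex"
  assumes "finite I"
    and "\<And>v. Im (\<Sum>i\<in>I. \<Sum>j\<in>I. cnj (v i) * \<sigma> i j * v j) = 0"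
    and "\<And>v. Re (\<Sum>i\<in>I. \<Sum>j\<in>I. cnj (v i) * \<sigma> i j * v j) \<ge> 0"
  shows "\<exists>\<psi>s :: ('a \<Rightarrow> complex) list. \<forall>i\<in>I. \<forall>j\<in>I. \<sigma> i j = (\<Sum>\<psi>\<leftarrow>\<psi>s. \<psi> i * cnj (\<psi> j))"
  using assms
proof (induction I arbitrary: \<sigma> rule: finite_induct)
  case (insert x I)
  define q where "q = (\<lambda>v. \<Sum>i\<in>I. \<Sum>j\<in>I. cnj (v i) * \<sigma> i j * v j)"
  \<comment> \<open>The quadratic form on \<open>insert x I\<close>, with the coordinate
    \<open>c\<close> at \<open>x\<close> separated from the vector \<open>v\<close> on
    \<open>I\<close>.\<close>
  define Q where "Q = (\<lambda>c v. cnj c * \<sigma> x x * c + cnj c * (\<Sum>j\<in>I. \<sigma> x j * v j)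
      + (\<Sum>i\<in>I. cnj (v i) * \<sigma> i x) * c + q v)"
  have Q: "(\<Sum>i\<in>insert x I. \<Sum>j\<in>insert x I. cnj ((v(x := c)) i) * \<sigma> i j * (v(x := c)) j) = Q c v" for c v
  proof -
    have ne: "i \<noteq> x" if "i \<in> I" for i using that insert.hyps by auto
    show ?thesis
      using insert.hyps ne
      by (simp add: Q_def q_def sum.distrib sum_distrib_left sum_distrib_right mult.assoc cong: sum.cong)
  qed
  have ImQ: "Im (Q c v) = 0" and ReQ: "Re (Q c v) \<ge> 0" for c v
    using insert.prems[of "v(x := c)"] unfolding Q by auto
  have x_real: "Im (\<sigma> x x) = 0" and x_nonneg: "Re (\<sigma> x x) \<ge> 0"
    using ImQ[of 1 "\<lambda>_. 0"] ReQ[of 1 "\<lambda>_. 0"] by (simp_all add: Q_def q_def)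
  define r where "r = Re (\<sigma> x x)"
  have xr: "\<sigma> x x = complex_of_real r" using x_real by (simp add: r_def complex_eq_iff)
  have r: "r \<ge> 0" using x_nonneg by (simp add: r_def)
  have Q1: "Q c (\<lambda>j. if j = i then 1 else 0) = cnj c * \<sigma> x x * c + cnj c * \<sigma> x i + \<sigma> i x * c + \<sigma> i i"
    if "i \<in> I" for c i
  proof -
    have "q (\<lambda>j. if j = i then 1 else 0) = \<sigma> i i"
      using that insert.hyps(1)
      by (simp add: q_def if_distrib[of cnj] if_distrib[of "\<lambda>z. z * _"] if_distrib[of "\<lambda>z. _ * z"] sum.delta cong: if_cong)
    then show ?thesis
      using that insert.hyps(1)
      by (simp add: Q_def if_distrib[of cnj] if_distrib[of "\<lambda>z. z * _"] if_distrib[of "\<lambda>z. _ * z"] sum.delta cong: if_cong)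
  qed
  \<comment> \<open>Reality of the form at the coordinate 1 fixes the imaginary parts of the two
    entries, and at the imaginary unit their real parts.\<close>
  have herm: "\<sigma> i x = cnj (\<sigma> x i)" if i: "i \<in> I" for i
  proof -
    have ii: "Im (\<sigma> i i) = 0"
      using ImQ[of 0 "\<lambda>j. if j = i then 1 else 0"] unfolding Q1[OF i] by simp
    show ?thesis
      using ImQ[of 1 "\<lambda>j. if j = i then 1 else 0"] ImQ[of \<i> "\<lambda>j. if j = i then 1 else 0"] ii
      unfolding Q1[OF i] xr by (simp add: complex_eq_iff)
  qed
  have zero: "\<sigma> x i = 0" if i: "i \<in> I" and r0: "r = 0" for i
  proof (rule ccontr)
    assume nz: "\<sigma> x i \<noteq> 0"
    \<comment> \<open>This \<open>t\<close> brings the form down to -1.\<close>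
    define t where "t = (Re (\<sigma> i i) + 1) / (2 * (cmod (\<sigma> x i))\<^sup>2)"
    have t: "2 * t * (cmod (\<sigma> x i))\<^sup>2 = Re (\<sigma> i i) + 1"
      using nz by (simp add: t_def)
    have "Re (Q (- (complex_of_real t * \<sigma> x i)) (\<lambda>j. if j = i then 1 else 0))
        = Re (\<sigma> i i) - 2 * t * (cmod (\<sigma> x i))\<^sup>2"
      unfolding Q1[OF i] herm[OF i] xr r0 cmod_power2 by (simp add: algebra_simps power2_eq_square)
    then show False using ReQ[of "- (complex_of_real t * \<sigma> x i)" "\<lambda>j. if j = i then 1 else 0"] t by simp
  qed
  define \<sigma>' where "\<sigma>' = (\<lambda>i j. \<sigma> i j - \<sigma> i x * \<sigma> x j / complex_of_real r)"
  \<comment> \<open>for \<open>r = 0\<close> the subtracted term is the junk value 0, which is what this case needs\<close>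
  have q': "(\<Sum>i\<in>I. \<Sum>j\<in>I. cnj (v i) * \<sigma>' i j * v j)
      = Q (- (\<Sum>j\<in>I. \<sigma> x j * v j) / complex_of_real r) v" for v
  proof -
    \<comment> \<open>For \<open>r > 0\<close> the coordinate \<open>- s / r\<close> minimises the
      form in \<open>c\<close>; completing the square leaves the form of the Schur
      complement.\<close>
    define s where "s = (\<Sum>j\<in>I. \<sigma> x j * v j)"
    have cs: "(\<Sum>i\<in>I. cnj (v i) * \<sigma> i x) = cnj s"
      unfolding s_def cnj_sum by (intro sum.cong refl) (simp add: herm)
    have "(\<Sum>i\<in>I. \<Sum>j\<in>I. cnj (v i) * \<sigma>' i j * v j) =
        q v - (\<Sum>i\<in>I. \<Sum>j\<in>I. (cnj (v i) * \<sigma> i x) * (\<sigma> x j * v j)) / complex_of_real r"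
      by (simp add: \<sigma>'_def q_def algebra_simps sum_subtractf sum_divide_distrib)
    also have "(\<Sum>i\<in>I. \<Sum>j\<in>I. (cnj (v i) * \<sigma> i x) * (\<sigma> x j * v j)) = cnj s * s"
      unfolding cs[symmetric] by (simp add: s_def sum_product)
    finally show ?thesis
      unfolding Q_def s_def[symmetric] cs xr by (cases "r = 0") (simp_all add: field_simps)
  qed
  obtain \<psi>s where \<psi>s: "\<And>i j. i \<in> I \<Longrightarrow> j \<in> I \<Longrightarrow> \<sigma>' i j = (\<Sum>\<psi>\<leftarrow>\<psi>s. \<psi> i * cnj (\<psi> j))"
    using insert.IH[of \<sigma>'] ImQ ReQ unfolding q' by blast
  define \<phi> where "\<phi> = (\<lambda>i. \<sigma> i x / complex_of_real (sqrt r))"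
  \<comment> \<open>The vectors from the induction hypothesis are unconstrained at \<open>x\<close>.
    They are set to 0 there, so that \<open>\<phi>\<close> alone produces the row and column of
    \<open>x\<close>.\<close>
  define ys where "ys = \<phi> # map (\<lambda>\<psi>. \<psi>(x := 0)) \<psi>s"
  have rr: "complex_of_real (sqrt r) * complex_of_real (sqrt r) = complex_of_real r"
    using r by (simp flip: of_real_mult)
  have x: "x \<notin> I" by fact
  have sum0: "(\<Sum>\<psi>\<leftarrow>\<psi>s. (0::complex)) = 0" by (induction \<psi>s) auto
  have "\<sigma> i j = (\<Sum>\<psi>\<leftarrow>ys. \<psi> i * cnj (\<psi> j))" if ij: "i \<in> insert x I" "j \<in> insert x I" for i j
  proof -
    have \<phi>\<phi>: "\<phi> i * cnj (\<phi> j) = \<sigma> i x * cnj (\<sigma> j x) / complex_of_real r"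
      by (simp add: \<phi>_def rr)
    have h': "cnj (\<sigma> j x) = \<sigma> x j"
      using ij(2) herm[of j] xr by (cases "j = x") simp_all
    have ys: "(\<Sum>\<psi>\<leftarrow>ys. \<psi> i * cnj (\<psi> j)) = \<sigma> i x * \<sigma> x j / complex_of_real r
       + (\<Sum>\<psi>\<leftarrow>\<psi>s. (\<psi>(x := 0)) i * cnj ((\<psi>(x := 0)) j))"
      by (simp add: ys_def \<phi>\<phi> h' o_def)
    show ?thesis
    proof (cases "i = x \<or> j = x")
      case True
      then have "(\<psi>(x := 0)) i * cnj ((\<psi>(x := 0)) j) = 0" for \<psi> :: "'a \<Rightarrow> complex" by auto
      then have "(\<Sum>\<psi>\<leftarrow>\<psi>s. (\<psi>(x := 0)) i * cnj ((\<psi>(x := 0)) j)) = 0" using sum0 by presburger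
      moreover have "\<sigma> i j = \<sigma> i x * \<sigma> x j / complex_of_real r"
      proof (cases "r = 0")
        case r0: True
        have "\<sigma> x k = 0" "\<sigma> k x = 0" if "k \<in> insert x I" for k
          using that zero[OF _ r0, of k] herm[of k] xr r0 by (cases "k = x"; simp)+
        then show ?thesis using True ij r0 by auto
      next
        case False
        then show ?thesis using True xr by auto
      qed
      ultimately show ?thesis using ys by simp
    next
      case False
      then have "i \<in> I" "j \<in> I" using ij by auto
      then have "\<sigma> i j - \<sigma> i x * \<sigma> x j / complex_of_real r = (\<Sum>\<psi>\<leftarrow>\<psi>s. \<psi> i * cnj (\<psi> j))"
        using \<psi>s unfolding \<sigma>'_def by blast
      then show ?thesis using False ys by (simp add: algebra_simps)
    qed
  qed
  then show ?case by blast
qed simp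

section \<open>Concurrence of pure states through minors\<close>

lemma sum_cfg_insert:
  assumes "k \<notin> S" "finite S"
  shows "(\<Sum>i\<in>cfg d (insert k S). F i) = (\<Sum>i\<in>cfg d S. \<Sum>a<d k. F (i(k := a)))"
proof -
  have "(\<Sum>i\<in>cfg d S. \<Sum>a<d k. F (i(k := a))) = (\<Sum>(i, a)\<in>cfg d S \<times> {..<d k}. F (i(k := a)))"
    by (rule sum.cartesian_product)
  also have "\<dots> = (\<Sum>i\<in>cfg d (insert k S). F i)"
    using assms(1)
    by (intro sum.reindex_bij_witness[of _ "\<lambda>i. (i(k := 0), i k)" "\<lambda>(i, a). i(k := a)"])
      (auto simp: cfg_def fun_eq_iff)
  finally show ?thesis ..
qed

lemma cfg_empty: "cfg d {} = {\<lambda>_. 0}"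
  by (auto simp: cfg_def)

lemma finite_cfg: "finite S \<Longrightarrow> finite (cfg d S)"
proof (induction S rule: finite_induct)
  case (insert k S)
  have "cfg d (insert k S) \<subseteq> (\<lambda>(i, a). i(k := a)) ` (cfg d S \<times> {..<d k})"
  proof
    fix i assume "i \<in> cfg d (insert k S)"
    then have "(i(k := 0), i k) \<in> cfg d S \<times> {..<d k}" using insert.hyps by (auto simp: cfg_def)
    then show "i \<in> (\<lambda>(i, a). i(k := a)) ` (cfg d S \<times> {..<d k})"
      by (rule image_eqI[rotated]) simp
  qed
  then show ?case using insert.IH finite_subset by blast
qed (simp add: cfg_empty)

lemma merge_cfg: "i \<in> cfg d S \<Longrightarrow> j \<in> cfg d S \<Longrightarrow> merge \<alpha> i j \<in> cfg d S"
  by (auto simp: cfg_def merge_def)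

lemma merge_merge: "merge \<alpha> (merge \<alpha> x z) (merge \<alpha> y w) = merge \<alpha> x w"
  by (auto simp: merge_def)

lemma merge_same: "merge \<alpha> x x = x"
  by (auto simp: merge_def)

lemma sum_cfg_merge:
  assumes "\<alpha> \<subseteq> S"
  shows "(\<Sum>i\<in>cfg d S. F i) = (\<Sum>x\<in>cfg d \<alpha>. \<Sum>z\<in>cfg d (S - \<alpha>). F (merge \<alpha> x z))"
proof -
  have "(\<Sum>x\<in>cfg d \<alpha>. \<Sum>z\<in>cfg d (S - \<alpha>). F (merge \<alpha> x z))
      = (\<Sum>(x, z)\<in>cfg d \<alpha> \<times> cfg d (S - \<alpha>). F (merge \<alpha> x z))"
    by (rule sum.cartesian_product)
  also have "\<dots> = (\<Sum>i\<in>cfg d S. F i)"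
    using assms
    by (intro sum.reindex_bij_witness[of _ "\<lambda>i. (merge \<alpha> i (\<lambda>_. 0), merge \<alpha> (\<lambda>_. 0) i)" "\<lambda>(x, z). merge \<alpha> x z"])
      (auto simp: cfg_def merge_def fun_eq_iff)
  finally show ?thesis ..
qed

text \<open>Exchanging the \<alpha> parts of two configurations is an involution on pairs.\<close>

lemma sum_cfg_swap:
  "(\<Sum>i\<in>cfg d S. \<Sum>j\<in>cfg d S. G (merge \<alpha> j i) (merge \<alpha> i j)) = (\<Sum>i\<in>cfg d S. \<Sum>j\<in>cfg d S. G i j)"
  unfolding sum.cartesian_product
  by (intro sum.reindex_bij_witness[of _ "\<lambda>(i, j). (merge \<alpha> j i, merge \<alpha> i j)" "\<lambda>(i, j). (merge \<alpha> j i, merge \<alpha> i j)"])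
    (auto simp: merge_merge merge_same merge_cfg)

text \<open>Cutting \<open>i\<close> into (x, z) and \<open>j\<close> into (y, z') along \<alpha>
  turns the double sum into the trace of the squared reduced operator. In this form the purity is
  the cross term of the squared minors.\<close>

lemma purity_proj_op:
  assumes "\<alpha> \<subseteq> {1..N}"
  shows "purity d N \<alpha> (proj_op \<phi>) = (\<Sum>i\<in>cfg d {1..N}. \<Sum>j\<in>cfg d {1..N}.
    (\<phi> i * \<phi> j) * cnj (\<phi> (merge \<alpha> j i) * \<phi> (merge \<alpha> i j)))"
proof -
  let ?A = "cfg d \<alpha>" and ?B = "cfg d ({1..N} - \<alpha>)" and ?m = "merge \<alpha>"
  have "(\<Sum>i\<in>cfg d {1..N}. \<Sum>j\<in>cfg d {1..N}. (\<phi> i * \<phi> j) * cnj (\<phi> (?m j i) * \<phi> (?m i j)))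
     = (\<Sum>x\<in>?A. \<Sum>z\<in>?B. \<Sum>y\<in>?A. \<Sum>z'\<in>?B.
         (\<phi> (?m x z) * \<phi> (?m y z')) * cnj (\<phi> (?m y z) * \<phi> (?m x z')))"
    unfolding sum_cfg_merge[OF assms] merge_merge ..
  also have "\<dots> = (\<Sum>x\<in>?A. \<Sum>y\<in>?A. \<Sum>z\<in>?B. \<Sum>z'\<in>?B.
         (\<phi> (?m x z) * \<phi> (?m y z')) * cnj (\<phi> (?m y z) * \<phi> (?m x z')))"
    by (intro sum.cong refl sum.swap)
  also have "\<dots> = purity d N \<alpha> (proj_op \<phi>)"
    unfolding purity_def ptrace_def proj_op_def sum_product
    by (intro sum.cong refl) (simp add: mult_ac)
  finally show ?thesis ..
qed

text \<open>The 2x2 minor, in rows and columns given by \<open>i\<close> and \<open>j\<close>, of \<open>\<phi>\<close> as a matrix across the cut \<open>\<alpha>\<close> versus its complement.\<close>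
definition minor :: "nat set \<Rightarrow> ((nat \<Rightarrow> nat) \<Rightarrow> complex) \<Rightarrow> (nat \<Rightarrow> nat) \<Rightarrow> (nat \<Rightarrow> nat) \<Rightarrow> complex" where
  "minor \<alpha> \<phi> i j = \<phi> i * \<phi> j - \<phi> (merge \<alpha> j i) * \<phi> (merge \<alpha> i j)"

text \<open>In the expansion of |a - b|^2 both square terms sum to the squared trace, the second by
  \<open>sum_cfg_swap\<close>, and the cross term is the purity.\<close>

lemma sum_minor_eq:
  assumes "\<alpha> \<subseteq> {1..N}"
  shows "(\<Sum>i\<in>cfg d {1..N}. \<Sum>j\<in>cfg d {1..N}. (cmod (minor \<alpha> \<phi> i j))\<^sup>2)
    = 2 * ((Re (trace_op d N (proj_op \<phi>)))\<^sup>2 - Re (purity d N \<alpha> (proj_op \<phi>)))"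
proof -
  let ?C = "cfg d {1..N}" and ?m = "merge \<alpha>"
  have sq: "(cmod (a - b))\<^sup>2 = (cmod a)\<^sup>2 + (cmod b)\<^sup>2 - 2 * Re (a * cnj b)" for a b
    by (simp only: cmod_power2) (simp add: algebra_simps power2_eq_square)
  have tr: "Re (trace_op d N (proj_op \<phi>)) = (\<Sum>i\<in>?C. (cmod (\<phi> i))\<^sup>2)"
    unfolding cmod_power2 by (simp add: trace_op_def proj_op_def power2_eq_square)
  have full: "(\<Sum>i\<in>?C. \<Sum>j\<in>?C. (cmod (\<phi> i * \<phi> j))\<^sup>2) = (Re (trace_op d N (proj_op \<phi>)))\<^sup>2"
    unfolding tr power2_eq_square[of "sum _ _"] sum_product by (simp add: norm_mult power_mult_distrib)
  have "(\<Sum>i\<in>?C. \<Sum>j\<in>?C. (cmod (minor \<alpha> \<phi> i j))\<^sup>2)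
     = (\<Sum>i\<in>?C. \<Sum>j\<in>?C. (cmod (\<phi> i * \<phi> j))\<^sup>2)
     + (\<Sum>i\<in>?C. \<Sum>j\<in>?C. (cmod (\<phi> (?m j i) * \<phi> (?m i j)))\<^sup>2)
     - 2 * Re (purity d N \<alpha> (proj_op \<phi>))"
    unfolding minor_def sq purity_proj_op[OF assms]
    by (simp only: sum_subtractf sum.distrib Re_sum sum_distrib_left)
  also have "(\<Sum>i\<in>?C. \<Sum>j\<in>?C. (cmod (\<phi> (?m j i) * \<phi> (?m i j)))\<^sup>2) = (\<Sum>i\<in>?C. \<Sum>j\<in>?C. (cmod (\<phi> i * \<phi> j))\<^sup>2)"
    by (rule sum_cfg_swap)
  finally show ?thesis unfolding full by simp
qed

text \<open>A set and its complement have the same minors up to exchanging two factors, so the six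
  proper subsets give each of the three cuts twice. This cancels the factor 2 of
  \<open>sum_minor_eq\<close>, and the remaining 1/2 is the square of the prefactor.\<close>

lemma conc_pure_3:
  "conc_pure d 3 \<phi> = sqrt (1/2 * (\<Sum>k\<in>{1,2,3}. \<Sum>i\<in>cfg d {1..3}. \<Sum>j\<in>cfg d {1..3}. (cmod (minor {k} \<phi> i j))\<^sup>2))"
proof -
  let ?C = "cfg d {1..3}"
  define D where "D = (\<lambda>\<alpha>. \<Sum>i\<in>?C. \<Sum>j\<in>?C. (cmod (minor \<alpha> \<phi> i j))\<^sup>2)"
  define t where "t = (Re (trace_op d 3 (proj_op \<phi>)))\<^sup>2"
  define p where "p = (\<lambda>\<alpha>. Re (purity d 3 \<alpha> (proj_op \<phi>)))"
  have D: "D \<alpha> = 2 * (t - p \<alpha>)" if "\<alpha> \<subseteq> {1..3}" for \<alpha>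
    unfolding D_def t_def p_def using sum_minor_eq[OF that] .
  have compl: "D ({1..3} - \<alpha>) = D \<alpha>" for \<alpha>
  proof -
    have "merge ({1..3} - \<alpha>) i j = merge \<alpha> j i" if "i \<in> ?C" "j \<in> ?C" for i j
      using that by (auto simp: cfg_def merge_def fun_eq_iff)
    then show ?thesis
      unfolding D_def minor_def by (intro sum.cong refl) (simp add: mult.commute)
  qed
  have s3: "{1..3} = {1, 2, 3::nat}" by auto
  have c: "D {2, 3} = D {1}" "D {1, 3} = D {2}" "D {1, 2} = D {3}"
    using compl[of "{1}"] compl[of "{2}"] compl[of "{3}"] unfolding s3 by (simp_all add: insert_Diff_if)
  have sub: "{\<alpha>. \<alpha> \<subseteq> {1..3::nat} \<and> \<alpha> \<noteq> {} \<and> \<alpha> \<noteq> {1..3}} = {{1}, {2}, {3}, {1, 2}, {1, 3}, {2, 3}}"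
  proof (intro equalityI subsetI)
    fix \<alpha> assume "\<alpha> \<in> {\<alpha>. \<alpha> \<subseteq> {1..3::nat} \<and> \<alpha> \<noteq> {} \<and> \<alpha> \<noteq> {1..3}}"
    then have \<alpha>: "\<alpha> \<subseteq> {1, 2, 3}" "\<alpha> \<noteq> {}" "\<alpha> \<noteq> {1, 2, 3}" unfolding s3 by auto
    have "\<alpha> = (if 1 \<in> \<alpha> then {1} else {}) \<union> (if 2 \<in> \<alpha> then {2} else {}) \<union> (if 3 \<in> \<alpha> then {3} else {})"
      using \<alpha>(1) by (auto split: if_splits)
    then obtain a b c where "\<alpha> = (if a then {1} else {}) \<union> (if b then {2} else {}) \<union> (if c then {3} else {})"
      by blast
    with \<alpha>(2,3) show "\<alpha> \<in> {{1}, {2}, {3}, {1, 2}, {1, 3}, {2, 3}}"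
      by (cases a; cases b; cases c; simp add: insert_commute)
  next
    fix \<alpha> :: "nat set" assume "\<alpha> \<in> {{1}, {2}, {3}, {1, 2}, {1, 3}, {2, 3}}"
    then have "\<alpha> \<subseteq> {1, 2, 3} \<and> \<alpha> \<noteq> {} \<and> \<not> {1, 2, 3} \<subseteq> \<alpha>"
      by (elim insertE) simp_all
    then show "\<alpha> \<in> {\<alpha>. \<alpha> \<subseteq> {1..3::nat} \<and> \<alpha> \<noteq> {} \<and> \<alpha> \<noteq> {1..3}}"
      unfolding s3 by auto
  qed
  have "(2 ^ 3 - 2) * t - (\<Sum>\<alpha>\<in>{\<alpha>. \<alpha> \<subseteq> {1..3::nat} \<and> \<alpha> \<noteq> {} \<and> \<alpha> \<noteq> {1..3}}. p \<alpha>)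
     = 6 * t - (p {1} + p {2} + p {3} + p {1, 2} + p {1, 3} + p {2, 3})"
    unfolding sub by (simp add: doubleton_eq_iff)
  also have "\<dots> = D {1} + D {2} + D {3}"
    using D[of "{1}"] D[of "{2}"] D[of "{3}"] D[of "{1, 2}"] D[of "{1, 3}"] D[of "{2, 3}"] c
    unfolding s3 by simp
  finally have e: "(2 ^ 3 - 2) * t - (\<Sum>\<alpha>\<in>{\<alpha>. \<alpha> \<subseteq> {1..3::nat} \<and> \<alpha> \<noteq> {} \<and> \<alpha> \<noteq> {1..3}}. p \<alpha>)
     = D {1} + D {2} + D {3}" .
  have half: "(2 powr (1 - real 3 / 2))\<^sup>2 = 1 / (2::real)"
  proof -
    have "(2 powr (1 - real 3 / 2))\<^sup>2 = (2::real) powr (-1)"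
      unfolding power2_eq_square by (simp flip: powr_add)
    then show ?thesis by (simp add: powr_minus)
  qed
  then have half': "2 powr (1 - real 3 / 2) = sqrt (1 / 2)"
    by (intro real_sqrt_unique[symmetric]) simp_all
  have "conc_pure d 3 \<phi> = sqrt (1/2 * (D {1} + D {2} + D {3}))"
    unfolding conc_pure_def Let_def half' Re_sum t_def[symmetric] p_def[symmetric] e real_sqrt_mult ..
  then show ?thesis unfolding D_def by simp
qed

section \<open>Minors of three-qubit vectors\<close>

definition conf :: "nat \<Rightarrow> nat \<Rightarrow> nat \<Rightarrow> nat \<Rightarrow> nat" where
  "conf a b c = (\<lambda>_. 0)(1 := a, 2 := b, 3 := c)"

lemma sum_cfg_3:
  "(\<Sum>i\<in>cfg d {1..3}. F i) = (\<Sum>a<d 1. \<Sum>b<d 2. \<Sum>c<d 3. F (conf a b c))"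
proof -
  have "{1..3} = insert 3 (insert 2 (insert 1 ({} :: nat set)))" by auto
  then show ?thesis by (simp add: sum_cfg_insert cfg_empty conf_def) (simp add: fun_upd_def)
qed

lemma merge_conf:
  "merge {1} (conf a b c) (conf a' b' c') = conf a b' c'"
  "merge {2} (conf a b c) (conf a' b' c') = conf a' b c'"
  "merge {3} (conf a b c) (conf a' b' c') = conf a' b' c"
  by (auto simp: merge_def conf_def)

text \<open>One column of the matrix W: the value \<open>z\<close> of the traced-out qubit
  \<open>r\<close> is fixed, and \<open>k\<close> runs through the basis of the pair in the order
  used by \<open>red2\<close>.\<close>

definition pair_amps :: "nat \<Rightarrow> nat \<Rightarrow> nat \<Rightarrow> ((nat \<Rightarrow> nat) \<Rightarrow> complex) \<Rightarrow> nat \<Rightarrow> nat \<Rightarrow> complex" where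
  "pair_amps m n r f z k = f ((\<lambda>_. 0)(m := k div 2, n := k mod 2, r := z))"

lemma pair_amps_conf:
  "pair_amps 1 2 3 f z k = f (conf (k div 2) (k mod 2) z)"
  "pair_amps 1 3 2 f z k = f (conf (k div 2) z (k mod 2))"
  "pair_amps 2 3 1 f z k = f (conf z (k div 2) (k mod 2))"
  by (simp_all add: pair_amps_def conf_def fun_upd_def) (auto intro!: arg_cong[of _ _ f])

lemma sum_lessThan_2: "(\<Sum>a<2. f a) = f 0 + f (1::nat)"
  for f :: "nat \<Rightarrow> 'a :: comm_monoid_add"
  by (simp add: numeral_2_eq_2)

lemma sum_2x2_minor:
  fixes x y :: "nat \<Rightarrow> complex"
  shows "(\<Sum>a<2. \<Sum>a'<2. (cmod (x a * y a' - x a' * y a))\<^sup>2) = 2 * (cmod (x 0 * y 1 - x 1 * y 0))\<^sup>2"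
  by (simp add: sum_lessThan_2 norm_minus_commute[of "x (Suc 0) * y 0"])

text \<open>\<open>X\<close> and \<open>Y\<close> are the two slices of a 2x2x2 array across a cut.
  A minor belongs to two column positions; equal positions give 0, and each of the six unordered
  pairs of distinct ones occurs twice.\<close>

lemma sum_slices:
  fixes X Y :: "nat \<Rightarrow> nat \<Rightarrow> complex"
  shows "(\<Sum>b<2. \<Sum>c<2. \<Sum>b'<2. \<Sum>c'<2. (cmod (X b c * Y b' c' - Y b c * X b' c'))\<^sup>2) =
    2 * ((cmod (X 0 0 * Y 1 1 - X 1 1 * Y 0 0))\<^sup>2 + (cmod (X 0 1 * Y 1 0 - X 1 0 * Y 0 1))\<^sup>2
     + (cmod (X 0 0 * Y 0 1 - X 0 1 * Y 0 0))\<^sup>2 + (cmod (X 1 0 * Y 1 1 - X 1 1 * Y 1 0))\<^sup>2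
     + (cmod (X 0 0 * Y 1 0 - X 1 0 * Y 0 0))\<^sup>2 + (cmod (X 0 1 * Y 1 1 - X 1 1 * Y 0 1))\<^sup>2)"
proof -
  define D where "D = (\<lambda>b c b' c'. (cmod (X b c * Y b' c' - Y b c * X b' c'))\<^sup>2)"
  have diag: "D b c b c = 0" for b c by (simp add: D_def mult.commute)
  have sym: "D b c b' c' = D b' c' b c" for b c b' c'
    by (simp add: D_def norm_minus_commute mult.commute)
  have "(\<Sum>b<2. \<Sum>c<2. \<Sum>b'<2. \<Sum>c'<2. D b c b' c')
     = 2 * (D 0 0 1 1 + D 0 1 1 0 + D 0 0 0 1 + D 1 0 1 1 + D 0 0 1 0 + D 0 1 1 1)"
    unfolding sum_lessThan_2
    using sym[of 1 1 0 0] sym[of 1 0 0 1] sym[of 0 1 0 0] sym[of 1 1 1 0] sym[of 1 0 0 0] sym[of 1 1 0 1]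
    unfolding diag by simp
  then show ?thesis by (simp add: D_def mult.commute)
qed

text \<open>The three sign patterns on the left form, with (1, 1, 1, 1), an orthogonal basis of
  vectors of squared length 4. Hence both sides equal four times the sum of the |p_i|^2 minus |p1 +
  p2 + p3 + p4|^2.\<close>

lemma antipodal_identity:
  fixes p1 p2 p3 p4 :: complex
  shows "(cmod (p2 + p3 - p1 - p4))\<^sup>2 + (cmod (p2 + p4 - p1 - p3))\<^sup>2 + (cmod (p3 + p4 - p1 - p2))\<^sup>2
    = (cmod (p1 - p2))\<^sup>2 + (cmod (p1 - p3))\<^sup>2 + (cmod (p1 - p4))\<^sup>2
    + (cmod (p2 - p3))\<^sup>2 + (cmod (p2 - p4))\<^sup>2 + (cmod (p3 - p4))\<^sup>2"
  by (simp only: cmod_power2) (simp add: power2_eq_square algebra_simps)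

lemma cmod_twice_minor:
  fixes x y u v :: complex
  shows "(cmod (x * y + y * x - u * v - v * u))\<^sup>2 = 4 * (cmod (u * v - x * y))\<^sup>2"
proof -
  have "x * y + y * x - u * v - v * u = - 2 * (u * v - x * y)" by (simp add: algebra_simps)
  then show ?thesis by (simp only: norm_mult power_mult_distrib) simp
qed

text \<open>The minors whose four amplitudes lie on one face of the cube of the eight amplitudes account for the
  terms with \<open>z = z'\<close>, those built from antipodal amplitudes for the terms with \<open>z \<noteq> z'\<close>.\<close>
lemma three_qubit_identity:
  "(\<Sum>(m, n, r)\<in>{(1, 2, 3), (1, 3, 2), (2, 3, 1)}. \<Sum>z<2. \<Sum>z'<2.
      (cmod (tau (pair_amps m n r f z) (pair_amps m n r f z')))\<^sup>2)
   = 1/2 * (\<Sum>k\<in>{1, 2, 3}. \<Sum>i\<in>cfg qubits {1..3}. \<Sum>j\<in>cfg qubits {1..3}. (cmod (minor {k} f i j))\<^sup>2)"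
proof -
  define F where "F = (\<lambda>a b c. f (conf a b c))"
  define q where "q = (\<lambda>z::complex. (cmod z)\<^sup>2)"
  \<comment> \<open>Each \<open>p\<close> is the product of two antipodal amplitudes of the cube.
    \<open>A\<close>, \<open>B\<close> and \<open>C\<close> are the squared minors on the faces with
    constant first, second and third index.\<close>
  define p1 where "p1 = F 0 0 0 * F 1 1 1"
  define p2 where "p2 = F 0 1 1 * F 1 0 0"
  define p3 where "p3 = F 1 0 1 * F 0 1 0"
  define p4 where "p4 = F 1 1 0 * F 0 0 1"
  define A where "A = (\<lambda>a. q (F a 0 0 * F a 1 1 - F a 0 1 * F a 1 0))"
  define B where "B = (\<lambda>b. q (F 0 b 0 * F 1 b 1 - F 0 b 1 * F 1 b 0))"
  define C where "C = (\<lambda>c. q (F 0 0 c * F 1 1 c - F 0 1 c * F 1 0 c))"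
  note defs = F_def q_def p1_def p2_def p3_def p4_def A_def B_def C_def
  have qs: "q (x - y) = q (y - x)" for x y by (simp add: q_def norm_minus_commute)
  define M where "M = (\<lambda>k. \<Sum>i\<in>cfg qubits {1..3}. \<Sum>j\<in>cfg qubits {1..3}. (cmod (minor {k} f i j))\<^sup>2)"
  \<comment> \<open>For each cut, the index of the separated party is summed first, which leaves the
    minors of two slices for \<open>sum_slices\<close>.\<close>
  have M1: "M 1 = 4 * (q (p1 - p2) + q (p3 - p4) + B 0 + B 1 + C 0 + C 1)"
  proof -
    have "M 1 = (\<Sum>a<2. \<Sum>b<2. \<Sum>c<2. \<Sum>a'<2. \<Sum>b'<2. \<Sum>c'<2. q (F a b c * F a' b' c' - F a' b c * F a b' c'))"
      unfolding M_def sum_cfg_3 qubits_def minor_def merge_conf F_def q_def ..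
    also have "\<dots> = (\<Sum>b<2. \<Sum>c<2. \<Sum>b'<2. \<Sum>c'<2. \<Sum>a<2. \<Sum>a'<2. q (F a b c * F a' b' c' - F a' b c * F a b' c'))"
      by (simp add: sum_lessThan_2)
    also have "\<dots> = 2 * (\<Sum>b<2. \<Sum>c<2. \<Sum>b'<2. \<Sum>c'<2. q (F 0 b c * F 1 b' c' - F 1 b c * F 0 b' c'))"
      unfolding q_def sum_2x2_minor sum_distrib_left ..
    also have "\<dots> = 4 * (q (p1 - p2) + q (p3 - p4) + B 0 + B 1 + C 0 + C 1)"
      unfolding q_def sum_slices
      using qs[of p3 p4] by (simp add: defs mult_ac)
    finally show ?thesis .
  qed
  have M2: "M 2 = 4 * (q (p1 - p3) + q (p2 - p4) + A 0 + A 1 + C 0 + C 1)"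
  proof -
    have "M 2 = (\<Sum>a<2. \<Sum>b<2. \<Sum>c<2. \<Sum>a'<2. \<Sum>b'<2. \<Sum>c'<2. q (F a b c * F a' b' c' - F a b' c * F a' b c'))"
      unfolding M_def sum_cfg_3 qubits_def minor_def merge_conf F_def q_def ..
    also have "\<dots> = (\<Sum>a<2. \<Sum>c<2. \<Sum>a'<2. \<Sum>c'<2. \<Sum>b<2. \<Sum>b'<2. q (F a b c * F a' b' c' - F a b' c * F a' b c'))"
      by (simp add: sum_lessThan_2)
    also have "\<dots> = 2 * (\<Sum>a<2. \<Sum>c<2. \<Sum>a'<2. \<Sum>c'<2. q (F a 0 c * F a' 1 c' - F a 1 c * F a' 0 c'))"
      unfolding q_def sum_2x2_minor[where x = "\<lambda>b. F _ b _" and y = "\<lambda>b. F _ b _"] sum_distrib_left ..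
    also have "\<dots> = 4 * (q (p1 - p3) + q (p2 - p4) + A 0 + A 1 + C 0 + C 1)"
      unfolding q_def sum_slices[where X = "\<lambda>a c. F a 0 c" and Y = "\<lambda>a c. F a 1 c"]
      using qs[of p2 p4] by (simp add: defs mult_ac)
    finally show ?thesis .
  qed
  have M3: "M 3 = 4 * (q (p1 - p4) + q (p2 - p3) + A 0 + A 1 + B 0 + B 1)"
  proof -
    have "M 3 = (\<Sum>a<2. \<Sum>b<2. \<Sum>c<2. \<Sum>a'<2. \<Sum>b'<2. \<Sum>c'<2. q (F a b c * F a' b' c' - F a b c' * F a' b' c))"
      unfolding M_def sum_cfg_3 qubits_def minor_def merge_conf F_def q_def ..
    also have "\<dots> = (\<Sum>a<2. \<Sum>b<2. \<Sum>a'<2. \<Sum>b'<2. \<Sum>c<2. \<Sum>c'<2. q (F a b c * F a' b' c' - F a b c' * F a' b' c))"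
      by (simp add: sum_lessThan_2)
    also have "\<dots> = 2 * (\<Sum>a<2. \<Sum>b<2. \<Sum>a'<2. \<Sum>b'<2. q (F a b 0 * F a' b' 1 - F a b 1 * F a' b' 0))"
      unfolding q_def sum_2x2_minor[where x = "F _ _" and y = "F _ _"] sum_distrib_left ..
    also have "\<dots> = 4 * (q (p1 - p4) + q (p2 - p3) + A 0 + A 1 + B 0 + B 1)"
      unfolding q_def sum_slices[where X = "\<lambda>a b. F a b 0" and Y = "\<lambda>a b. F a b 1"]
      using qs[of p2 p3] by (simp add: defs mult_ac)
    finally show ?thesis .
  qed
  define N where "N = (\<lambda>m n r. \<Sum>z<2. \<Sum>z'<2. (cmod (tau (pair_amps m n r f z) (pair_amps m n r f z')))\<^sup>2)"
  have expand: "N m n r = q (tau (w 0) (w 0)) + q (tau (w 1) (w 1)) + 2 * q (tau (w 0) (w 1))"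
    if "w = pair_amps m n r f" for m n r w
    using tau_commute[of "w 1" "w 0"] unfolding N_def sum_lessThan_2 q_def that by simp
  have N12: "N 1 2 3 = 4 * (C 0 + C 1) + 2 * q (p2 + p3 - p1 - p4)"
  proof -
    have t: "tau (pair_amps 1 2 3 f z) (pair_amps 1 2 3 f z')
       = F 0 1 z * F 1 0 z' + F 1 0 z * F 0 1 z' - F 0 0 z * F 1 1 z' - F 1 1 z * F 0 0 z'" for z z'
      by (simp add: tau_def pair_amps_conf[unfolded One_nat_def] F_def)
    have "q (tau (pair_amps 1 2 3 f z) (pair_amps 1 2 3 f z)) = 4 * C z" for z
      unfolding t q_def cmod_twice_minor by (simp add: C_def q_def)
    moreover have "tau (pair_amps 1 2 3 f 0) (pair_amps 1 2 3 f 1) = p2 + p3 - p1 - p4"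
      unfolding t by (simp add: defs)
    ultimately show ?thesis unfolding expand[OF refl] by simp
  qed
  have N13: "N 1 3 2 = 4 * (B 0 + B 1) + 2 * q (p2 + p4 - p1 - p3)"
  proof -
    have t: "tau (pair_amps 1 3 2 f z) (pair_amps 1 3 2 f z')
       = F 0 z 1 * F 1 z' 0 + F 1 z 0 * F 0 z' 1 - F 0 z 0 * F 1 z' 1 - F 1 z 1 * F 0 z' 0" for z z'
      by (simp add: tau_def pair_amps_conf[unfolded One_nat_def] F_def)
    have "q (tau (pair_amps 1 3 2 f z) (pair_amps 1 3 2 f z)) = 4 * B z" for z
      unfolding t q_def cmod_twice_minor by (simp add: B_def q_def)
    moreover have "tau (pair_amps 1 3 2 f 0) (pair_amps 1 3 2 f 1) = p2 + p4 - p1 - p3"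
      unfolding t by (simp add: defs)
    ultimately show ?thesis unfolding expand[OF refl] by simp
  qed
  have N23: "N 2 3 1 = 4 * (A 0 + A 1) + 2 * q (p3 + p4 - p1 - p2)"
  proof -
    have t: "tau (pair_amps 2 3 1 f z) (pair_amps 2 3 1 f z')
       = F z 0 1 * F z' 1 0 + F z 1 0 * F z' 0 1 - F z 0 0 * F z' 1 1 - F z 1 1 * F z' 0 0" for z z'
      by (simp add: tau_def pair_amps_conf[unfolded One_nat_def] F_def)
    have "q (tau (pair_amps 2 3 1 f z) (pair_amps 2 3 1 f z)) = 4 * A z" for z
      unfolding t q_def cmod_twice_minor by (simp add: A_def q_def)
    moreover have "tau (pair_amps 2 3 1 f 0) (pair_amps 2 3 1 f 1) = p3 + p4 - p1 - p2"
      unfolding t by (simp add: defs)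
    ultimately show ?thesis unfolding expand[OF refl] by simp
  qed
  \<comment> \<open>Every face term occurs for two of the three cuts, which after halving matches
    its coefficient 4 on the left. The premise is the identity for the antipodal products.\<close>
  have gen: "4 * (c + c') + 2 * x + (4 * (b + b') + 2 * y) + (4 * (a + a') + 2 * z)
      = 1/2 * (4 * (s + s' + b + b' + c + c') + 4 * (t + t' + a + a' + c + c') + 4 * (u + u' + a + a' + b + b'))"
    if "x + y + z = s + t + u + u' + t' + s'" for a a' b b' c c' s s' t t' u u' x y z :: real
    using that by (simp add: algebra_simps)
  have "N 1 2 3 + N 1 3 2 + N 2 3 1 = 1/2 * (M 1 + M 2 + M 3)"
    unfolding M1 M2 M3 N12 N13 N23 
    by (rule gen) (simp only: q_def antipodal_identity)
  then have "(\<Sum>(m, n, r)\<in>{(1, 2, 3), (1, 3, 2), (2, 3, 1)}. N m n r) = 1/2 * (\<Sum>k\<in>{1, 2, 3}. M k)"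
    by simp
  then show ?thesis unfolding N_def M_def .
qed

section \<open>Substates\<close>

definition emb :: "(nat \<Rightarrow> nat set) \<Rightarrow> (nat \<Rightarrow> nat) \<Rightarrow> nat \<Rightarrow> nat" where
  "emb S a = (\<lambda>k. if k \<in> {1, 2, 3} then sorted_list_of_set (S k) ! a k else 0)"

lemma substate_emb: "substate S \<rho> a b = \<rho> (emb S a) (emb S b)"
  by (simp add: substate_def emb_def)

lemma merge_emb: "merge \<alpha> (emb S a) (emb S b) = emb S (merge \<alpha> a b)"
  by (auto simp: merge_def emb_def)

text \<open>The embedding acts on each party separately and so commutes with \<open>merge\<close>:
  minors of a substate vector are minors of the full vector.\<close>

lemma minor_emb: "minor \<alpha> \<phi> (emb S a) (emb S b) = minor \<alpha> (\<phi> \<circ> emb S) a b"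
  by (simp add: minor_def merge_emb)

lemma cfg_3_iff: "i \<in> cfg d {1..3} \<longleftrightarrow> (\<forall>k\<in>{1, 2, 3}. i k < d k) \<and> (\<forall>k. k \<notin> {1, 2, 3} \<longrightarrow> i k = 0)"
proof -
  have "{1..3} = {1, 2, 3::nat}" by auto
  then show ?thesis by (simp only: cfg_def mem_Collect_eq)
qed

lemma emb_mem:
  assumes S: "S \<in> substate_choices d" and a: "a \<in> cfg qubits {1..3}" and k: "k \<in> {1, 2, 3}"
  shows "emb S a k \<in> S k" "emb S a k < d k"
proof -
  have Sk: "S k \<subseteq> {0..<d k}" "card (S k) = 2"
    using S k by (auto simp: substate_choices_def)
  have ak: "a k < 2" using a k unfolding cfg_3_iff qubits_def by blast
  have "finite (S k)" using Sk(1) by (rule finite_subset) simp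
  then show "emb S a k \<in> S k"
    using Sk(2) ak k nth_mem[of "a k" "sorted_list_of_set (S k)"] by (simp add: emb_def)
  with Sk(1) show "emb S a k < d k" by auto
qed

lemma emb_cfg:
  assumes "S \<in> substate_choices d" "a \<in> cfg qubits {1..3}"
  shows "emb S a \<in> cfg d {1..3}"
  unfolding cfg_3_iff using emb_mem(2)[OF assms] by (simp add: emb_def)

lemma inj_on_emb:
  assumes S: "S \<in> substate_choices d"
  shows "inj_on (emb S) (cfg qubits {1..3})"
proof (rule inj_onI, rule ext)
  fix a b k assume a: "a \<in> cfg qubits {1..3}" and b: "b \<in> cfg qubits {1..3}" and eq: "emb S a = emb S b"
  show "a k = b k"
  proof (cases "k \<in> {1, 2, 3}")
    case True
    then have "card (S k) = 2" "a k < 2" "b k < 2"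
      using S a b unfolding substate_choices_def cfg_3_iff qubits_def by blast+
    moreover have "sorted_list_of_set (S k) ! a k = sorted_list_of_set (S k) ! b k"
      using fun_cong[OF eq, of k] True by (simp add: emb_def)
    ultimately show ?thesis
      by (simp add: nth_eq_iff_index_eq)
  next
    case False
    then show ?thesis using a b unfolding cfg_3_iff by simp
  qed
qed

definition triple :: "nat set \<times> nat set \<times> nat set \<Rightarrow> nat \<Rightarrow> nat set" where
  "triple = (\<lambda>(A, B, C) k. if k = 1 then A else if k = 2 then B else if k = 3 then C else {})"

lemma finite_substate_choices: "finite (substate_choices d)"
proof -
  have "substate_choices d \<subseteq> triple ` (Pow {0..<d 1} \<times> Pow {0..<d 2} \<times> Pow {0..<d 3})"
  proof
    fix S assume S: "S \<in> substate_choices d"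
    have "S = triple (S 1, S 2, S 3)"
      using S by (auto simp: triple_def substate_choices_def fun_eq_iff)
    moreover have "(S 1, S 2, S 3) \<in> Pow {0..<d 1} \<times> Pow {0..<d 2} \<times> Pow {0..<d 3}"
      using S by (auto simp: substate_choices_def)
    ultimately show "S \<in> triple ` (Pow {0..<d 1} \<times> Pow {0..<d 2} \<times> Pow {0..<d 3})" by blast
  qed
  then show ?thesis by (rule finite_subset) simp
qed

text \<open>Source of the constant in the theorem: a choice whose sets contain the entries of
  \<open>i\<close> is fixed by the other element of each \<open>S k\<close>, for which there are
  \<open>d k - 1\<close> values.\<close>

lemma card_choices_containing:
  assumes i: "i \<in> cfg d {1..3}"
  shows "card {S \<in> substate_choices d. \<forall>k\<in>{1, 2, 3}. i k \<in> S k} \<le> (d 1 - 1) * (d 2 - 1) * (d 3 - 1)"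
proof -
  let ?R = "\<lambda>k. {0..<d k} - {i k}"
  let ?g = "\<lambda>(x, y, z). triple ({i 1, x}, {i 2, y}, {i 3, z})"
  have "{S \<in> substate_choices d. \<forall>k\<in>{1, 2, 3}. i k \<in> S k} \<subseteq> ?g ` (?R 1 \<times> ?R 2 \<times> ?R 3)"
  proof
    fix S assume S: "S \<in> {S \<in> substate_choices d. \<forall>k\<in>{1, 2, 3}. i k \<in> S k}"
    have ex: "\<exists>x. x \<in> ?R k \<and> S k = {i k, x}" if k: "k \<in> {1, 2, 3}" for k
    proof -
      have Sk: "S k \<subseteq> {0..<d k}" "card (S k) = 2" "i k \<in> S k"
        using S k by (auto simp: substate_choices_def)
      then obtain x where "S k = {i k, x}" "x \<noteq> i k"
        by (auto simp: card_2_iff insert_commute)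
      with Sk(1) show ?thesis by (intro exI[of _ x]) auto
    qed
    obtain x y z where xyz: "x \<in> ?R 1" "S 1 = {i 1, x}" "y \<in> ?R 2" "S 2 = {i 2, y}" "z \<in> ?R 3" "S 3 = {i 3, z}"
      using ex[of 1] ex[of 2] ex[of 3] by auto
    have "S = ?g (x, y, z)"
      using S xyz by (auto simp: triple_def substate_choices_def fun_eq_iff)
    moreover have "(x, y, z) \<in> ?R 1 \<times> ?R 2 \<times> ?R 3" using xyz by blast
    ultimately show "S \<in> ?g ` (?R 1 \<times> ?R 2 \<times> ?R 3)" by (rule image_eqI)
  qed
  then have "card {S \<in> substate_choices d. \<forall>k\<in>{1, 2, 3}. i k \<in> S k} \<le> card (?R 1 \<times> ?R 2 \<times> ?R 3)"
    by (rule surj_card_le[rotated]) simp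
  also have "\<dots> = (d 1 - 1) * (d 2 - 1) * (d 3 - 1)"
    using i unfolding cfg_3_iff by (simp add: card_cartesian_product mult.assoc)
  finally show ?thesis .
qed

text \<open>Within each substate the sum over the second configuration is enlarged to all
  \<open>j\<close>. Each \<open>i\<close> is then counted once for every substate containing it,
  which \<open>card_choices_containing\<close> bounds.\<close>

lemma sum_substates_le:
  fixes g :: "(nat \<Rightarrow> nat) \<Rightarrow> (nat \<Rightarrow> nat) \<Rightarrow> real"
  assumes g: "\<And>i j. g i j \<ge> 0"
  shows "(\<Sum>S\<in>substate_choices d. \<Sum>a\<in>cfg qubits {1..3}. \<Sum>b\<in>cfg qubits {1..3}. g (emb S a) (emb S b))
    \<le> real ((d 1 - 1) * (d 2 - 1) * (d 3 - 1)) * (\<Sum>i\<in>cfg d {1..3}. \<Sum>j\<in>cfg d {1..3}. g i j)"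
proof -
  let ?C = "cfg d {1..3}" and ?Q = "cfg qubits {1..3}"
  let ?box = "\<lambda>S. {i \<in> ?C. \<forall>k\<in>{1, 2, 3}. i k \<in> S k}"
  define G where "G = (\<lambda>i. \<Sum>j\<in>?C. g i j)"
  have fin: "finite ?C" by (rule finite_cfg) simp
  have G: "G i \<ge> 0" for i unfolding G_def by (intro sum_nonneg g)
  have "(\<Sum>a\<in>?Q. \<Sum>b\<in>?Q. g (emb S a) (emb S b)) \<le> (\<Sum>i\<in>?C. if \<forall>k\<in>{1, 2, 3}. i k \<in> S k then G i else 0)"
    if S: "S \<in> substate_choices d" for S
  proof -
    have sub: "emb S ` ?Q \<subseteq> ?box S" using emb_mem(1)[OF S] emb_cfg[OF S] by blast
    have "(\<Sum>a\<in>?Q. \<Sum>b\<in>?Q. g (emb S a) (emb S b)) = (\<Sum>i\<in>emb S ` ?Q. \<Sum>j\<in>emb S ` ?Q. g i j)"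
      using inj_on_emb[OF S] by (simp add: sum.reindex)
    also have "\<dots> \<le> (\<Sum>i\<in>emb S ` ?Q. G i)"
      unfolding G_def using sub fin g by (intro sum_mono sum_mono2) auto
    also have "\<dots> \<le> (\<Sum>i\<in>?box S. G i)"
      using sub fin G by (intro sum_mono2) auto
    also have "\<dots> = (\<Sum>i\<in>?C. if \<forall>k\<in>{1, 2, 3}. i k \<in> S k then G i else 0)"
      using fin by (rule sum.inter_filter)
    finally show ?thesis .
  qed
  then have "(\<Sum>S\<in>substate_choices d. \<Sum>a\<in>?Q. \<Sum>b\<in>?Q. g (emb S a) (emb S b))
      \<le> (\<Sum>S\<in>substate_choices d. \<Sum>i\<in>?C. if \<forall>k\<in>{1, 2, 3}. i k \<in> S k then G i else 0)"
    by (rule sum_mono)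
  also have "\<dots> = (\<Sum>i\<in>?C. \<Sum>S\<in>substate_choices d. if \<forall>k\<in>{1, 2, 3}. i k \<in> S k then G i else 0)"
    by (rule sum.swap)
  also have "\<dots> = (\<Sum>i\<in>?C. real (card {S \<in> substate_choices d. \<forall>k\<in>{1, 2, 3}. i k \<in> S k}) * G i)"
    unfolding sum.inter_filter[OF finite_substate_choices, symmetric] sum_constant ..
  also have "\<dots> \<le> (\<Sum>i\<in>?C. real ((d 1 - 1) * (d 2 - 1) * (d 3 - 1)) * G i)"
    by (intro sum_mono mult_right_mono G) (simp only: of_nat_le_iff card_choices_containing)
  finally show ?thesis by (simp only: G_def sum_distrib_left)
qed

section \<open>From pure states to ensembles\<close>

text \<open>The bound for a single vector: \<open>three_qubit_identity\<close> turns each substate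
  into minors, and \<open>sum_substates_le\<close> counts these for each cut.\<close>

lemma pairs_bound:
  "(\<Sum>S\<in>substate_choices d. \<Sum>(m, n, r)\<in>{(1, 2, 3), (1, 3, 2), (2, 3, 1)}. \<Sum>z<2. \<Sum>z'<2.
      (cmod (tau (pair_amps m n r (\<psi> \<circ> emb S) z) (pair_amps m n r (\<psi> \<circ> emb S) z')))\<^sup>2)
   \<le> real ((d 1 - 1) * (d 2 - 1) * (d 3 - 1)) * (conc_pure d 3 \<psi>)\<^sup>2"
proof -
  let ?P = "real ((d 1 - 1) * (d 2 - 1) * (d 3 - 1))"
  let ?C = "cfg d {1..3}" and ?Q = "cfg qubits {1..3}"
  have "(\<Sum>S\<in>substate_choices d. \<Sum>(m, n, r)\<in>{(1, 2, 3), (1, 3, 2), (2, 3, 1)}. \<Sum>z<2. \<Sum>z'<2.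
      (cmod (tau (pair_amps m n r (\<psi> \<circ> emb S) z) (pair_amps m n r (\<psi> \<circ> emb S) z')))\<^sup>2)
    = (\<Sum>S\<in>substate_choices d. 1/2 * (\<Sum>k\<in>{1, 2, 3}. \<Sum>a\<in>?Q. \<Sum>b\<in>?Q. (cmod (minor {k} \<psi> (emb S a) (emb S b)))\<^sup>2))"
    unfolding three_qubit_identity minor_emb ..
  also have "\<dots> = 1/2 * (\<Sum>k\<in>{1, 2, 3}. \<Sum>S\<in>substate_choices d. \<Sum>a\<in>?Q. \<Sum>b\<in>?Q. (cmod (minor {k} \<psi> (emb S a) (emb S b)))\<^sup>2)"
    unfolding sum_distrib_left[symmetric] by (subst sum.swap) (rule refl)
  also have "\<dots> \<le> 1/2 * (\<Sum>k\<in>{1, 2, 3}. ?P * (\<Sum>i\<in>?C. \<Sum>j\<in>?C. (cmod (minor {k} \<psi> i j))\<^sup>2))"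
    by (intro mult_left_mono sum_mono sum_substates_le) auto
  also have "\<dots> = ?P * (conc_pure d 3 \<psi>)\<^sup>2"
  proof -
    have "1/2 * (\<Sum>k\<in>{1, 2, 3}. \<Sum>i\<in>?C. \<Sum>j\<in>?C. (cmod (minor {k} \<psi> i j))\<^sup>2) \<ge> 0"
      by (intro mult_nonneg_nonneg sum_nonneg) auto
    then have "(conc_pure d 3 \<psi>)\<^sup>2 = 1/2 * (\<Sum>k\<in>{1, 2, 3}. \<Sum>i\<in>?C. \<Sum>j\<in>?C. (cmod (minor {k} \<psi> i j))\<^sup>2)"
      unfolding conc_pure_3 by (rule real_sqrt_pow2)
    then show ?thesis
      unfolding sum_distrib_left[symmetric] by (simp only: mult.left_commute)
  qed
  finally show ?thesis .
qed

lemma Cmn_substate_le: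
  assumes dec: "is_decomp d 3 \<rho> \<psi>s" and S: "S \<in> substate_choices d"
    and mnr: "(m, n, r) \<in> {(1, 2, 3), (1, 3, 2), (2, 3, 1)}"
  shows "Cmn m n (substate S \<rho>) \<le> (\<Sum>i<length \<psi>s. sqrt (\<Sum>z<2. \<Sum>z'<2.
    (cmod (tau (pair_amps m n r (\<psi>s ! i \<circ> emb S) z) (pair_amps m n r (\<psi>s ! i \<circ> emb S) z')))\<^sup>2))"
proof -
  define N where "N = length \<psi>s"
  \<comment> \<open>The index \<open>p = 2 * i + z\<close> stands for ensemble vector
    \<open>i\<close> and state \<open>z\<close> of the traced-out qubit, so the blocks for
    \<open>wootters_le\<close> are the pairs \<open>2 * i\<close>, \<open>2 * i + 1\<close>.\<close>
  define w where "w = (\<lambda>p. pair_amps m n r (\<psi>s ! (p div 2) \<circ> emb S) (p mod 2))"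
  define x where "x = (\<lambda>k z. (\<lambda>_. 0 :: nat)(m := k div 2, n := k mod 2, r := z))"
  have s3: "{1..3} = {1, 2, 3::nat}" by auto
  have mr: "m \<noteq> n" "m \<noteq> r" "n \<noteq> r" "{1..3} - {m, n} = {r}" "m \<in> {1..3}" "n \<in> {1..3}" "r \<in> {1..3}"
    using mnr unfolding s3 by auto
  have merge_x: "merge {m, n} ((\<lambda>_. 0)(m := k div 2, n := k mod 2)) ((\<lambda>_. 0)(r := z)) = x k z" for k z
    using mr(1-3) by (auto simp: merge_def x_def fun_eq_iff)
  have xQ: "x k z \<in> cfg qubits {1..3}" if "k < 4" "z < 2" for k z
  proof -
    have "k div 2 < 2" "k mod 2 < 2" using that(1) by auto
    then have "x k z j < qubits j" for j
      using that(2) by (simp add: x_def qubits_def)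
    moreover have "x k z j = 0" if "j \<notin> {1..3}" for j
    proof -
      have "j \<noteq> m" "j \<noteq> n" "j \<noteq> r" using that mr(5-7) by blast+
      then show ?thesis by (simp add: x_def)
    qed
    ultimately show ?thesis unfolding cfg_def by blast
  qed
  have ent: "substate S \<rho> (x k z) (x l z) = (\<Sum>i<N. w (2 * i + z) k * cnj (w (2 * i + z) l))"
    if "k < 4" "l < 4" "z < 2" for k l z
  proof -
    have "substate S \<rho> (x k z) (x l z) = (\<Sum>\<psi>\<leftarrow>\<psi>s. \<psi> (emb S (x k z)) * cnj (\<psi> (emb S (x l z))))"
      using dec emb_cfg[OF S xQ] that by (simp add: substate_emb is_decomp_def)
    also have "\<dots> = (\<Sum>i<N. (\<psi>s ! i) (emb S (x k z)) * cnj ((\<psi>s ! i) (emb S (x l z))))"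
      by (simp add: sum_list_sum_nth N_def lessThan_atLeast0)
    finally show ?thesis
      using \<open>z < 2\<close> by (simp add: w_def pair_amps_def x_def)
  qed
  have sum2N: "(\<Sum>p<2 * N. h p) = (\<Sum>z<2. \<Sum>i<N. h (2 * i + z))" for h :: "nat \<Rightarrow> complex"
    by (induction N) (simp_all add: sum_lessThan_2 algebra_simps)
  have sum_cfg_single: "(\<Sum>y\<in>cfg qubits {r}. h y) = (\<Sum>z<2. h ((\<lambda>_. 0)(r := z)))" for h :: "(nat \<Rightarrow> nat) \<Rightarrow> complex"
    using sum_cfg_insert[where d = qubits and k = r and S = "{}" and F = h]
    by (simp only: empty_iff not_False_eq_True finite.emptyI cfg_empty qubits_def) (simp add: fun_upd_def)
  have "red2 m n (substate S \<rho>) = mat 4 4 (\<lambda>(k, l). \<Sum>p<2 * N. w p k * cnj (w p l))"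
  proof (rule eq_matI)
    fix k l assume "k < dim_row (mat 4 4 (\<lambda>(k, l). \<Sum>p<2 * N. w p k * cnj (w p l)))"
      "l < dim_col (mat 4 4 (\<lambda>(k, l). \<Sum>p<2 * N. w p k * cnj (w p l)))"
    then have kl: "k < 4" "l < 4" by auto
    have "ptrace qubits 3 {m, n} (substate S \<rho>)
        ((\<lambda>_. 0)(m := k div 2, n := k mod 2)) ((\<lambda>_. 0)(m := l div 2, n := l mod 2))
      = (\<Sum>z<2. substate S \<rho> (x k z) (x l z))"
      unfolding ptrace_def mr(4) sum_cfg_single merge_x ..
    also have "\<dots> = (\<Sum>p<2 * N. w p k * cnj (w p l))"
      unfolding sum2N using ent[OF kl] by simp
    finally show "red2 m n (substate S \<rho>) $$ (k, l) = mat 4 4 (\<lambda>(k, l). \<Sum>p<2 * N. w p k * cnj (w p l)) $$ (k, l)"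
      using kl by (simp add: red2_def)
  qed (auto simp: red2_def)
  then have "Cmn m n (substate S \<rho>) = wootters (mat 4 4 (\<lambda>(k, l). \<Sum>p<2 * N. w p k * cnj (w p l)))"
    by (simp add: Cmn_def)
  also have "\<dots> \<le> (\<Sum>i<N. L2_set (\<lambda>(p, p'). cmod (tau (w p) (w p'))) ({2 * i, 2 * i + 1} \<times> {2 * i, 2 * i + 1}))"
  proof (rule wootters_le)
    show "(\<Union>i<N. {2 * i, 2 * i + 1}) = {..<2 * N}"
    proof (intro equalityI subsetI)
      fix p assume "p \<in> {..<2 * N}"
      then have "p div 2 < N" "p = 2 * (p div 2) \<or> p = 2 * (p div 2) + 1" by auto
      then show "p \<in> (\<Union>i<N. {2 * i, 2 * i + 1})" by blast
    qed auto
    show "disjoint_family_on (\<lambda>i. {2 * i, 2 * i + 1}) {..<N}"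
      unfolding disjoint_family_on_def by (auto; presburger)
  qed simp
  also have "\<dots> = (\<Sum>i<N. sqrt (\<Sum>z<2. \<Sum>z'<2.
    (cmod (tau (pair_amps m n r (\<psi>s ! i \<circ> emb S) z) (pair_amps m n r (\<psi>s ! i \<circ> emb S) z')))\<^sup>2))"
  proof (intro sum.cong refl)
    fix i
    show "L2_set (\<lambda>(p, p'). cmod (tau (w p) (w p'))) ({2 * i, 2 * i + 1} \<times> {2 * i, 2 * i + 1})
      = sqrt (\<Sum>z<2. \<Sum>z'<2.
        (cmod (tau (pair_amps m n r (\<psi>s ! i \<circ> emb S) z) (pair_amps m n r (\<psi>s ! i \<circ> emb S) z')))\<^sup>2)"
      by (simp add: L2_set_def sum_lessThan_2 w_def case_prod_unfold Times_insert_left)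
  qed
  finally show ?thesis by (simp add: N_def)
qed

text \<open>The left side is an L2 norm over all substates and pairs of qubits. Each entry is at
  most a sum over the ensemble, Minkowski's inequality takes that sum out of the norm, and
  \<open>pairs_bound\<close> treats each vector.\<close>

lemma sum_conc_pure_ge:
  assumes dec: "is_decomp d 3 \<rho> \<psi>s"
  shows "sqrt (\<Sum>S\<in>substate_choices d. \<Sum>(m, n)\<in>{(1, 2), (1, 3), (2, 3)}. (Cmn m n (substate S \<rho>))\<^sup>2)
    \<le> sqrt (real ((d 1 - 1) * (d 2 - 1) * (d 3 - 1))) * (\<Sum>\<psi>\<leftarrow>\<psi>s. conc_pure d 3 \<psi>)"
proof -
  let ?P = "real ((d 1 - 1) * (d 2 - 1) * (d 3 - 1))"
  let ?J = "{(1, 2, 3), (1, 3, 2), (2, 3, 1)} :: (nat \<times> nat \<times> nat) set"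
  let ?A = "substate_choices d \<times> ?J"
  define N where "N = length \<psi>s"
  define h where "h = (\<lambda>i (S, m, n, r). sqrt (\<Sum>z<2. \<Sum>z'<2.
    (cmod (tau (pair_amps m n r (\<psi>s ! i \<circ> emb S) z) (pair_amps m n r (\<psi>s ! i \<circ> emb S) z')))\<^sup>2))"
  \<comment> \<open>The third qubit \<open>r\<close> is determined by the pair, so summing over
    triples adds no terms.\<close>
  have "sqrt (\<Sum>S\<in>substate_choices d. \<Sum>(m, n)\<in>{(1, 2), (1, 3), (2, 3)}. (Cmn m n (substate S \<rho>))\<^sup>2)
     = L2_set (\<lambda>(S, m, n, r). Cmn m n (substate S \<rho>)) ?A"
    unfolding L2_set_def sum.cartesian_product' by (simp add: sum.distrib)
  also have "\<dots> \<le> L2_set (\<lambda>p. \<Sum>i<N. h i p) ?A"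
  proof (rule L2_set_mono)
    fix p assume "p \<in> ?A"
    then obtain S m n r where p: "p = (S, m, n, r)" "S \<in> substate_choices d" "(m, n, r) \<in> ?J"
      by (cases p) auto
    show "(case p of (S, m, n, r) \<Rightarrow> Cmn m n (substate S \<rho>)) \<le> (\<Sum>i<N. h i p)"
      using Cmn_substate_le[OF dec p(2,3)] by (simp add: p(1) h_def N_def)
    show "0 \<le> (case p of (S, m, n, r) \<Rightarrow> Cmn m n (substate S \<rho>))"
      by (simp add: p(1) Cmn_def wootters_def Let_def)
  qed
  also have "\<dots> \<le> (\<Sum>i<N. L2_set (h i) ?A)" by (rule L2_set_sum_le)
  also have "\<dots> \<le> (\<Sum>i<N. sqrt ?P * conc_pure d 3 (\<psi>s ! i))"
  proof (rule sum_mono)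
    fix i
    have nn: "conc_pure d 3 (\<psi>s ! i) \<ge> 0"
      unfolding conc_pure_3 by (intro real_sqrt_ge_zero mult_nonneg_nonneg sum_nonneg) auto
    have hh: "(h i (S, m, n, r))\<^sup>2 = (\<Sum>z<2. \<Sum>z'<2.
      (cmod (tau (pair_amps m n r (\<psi>s ! i \<circ> emb S) z) (pair_amps m n r (\<psi>s ! i \<circ> emb S) z')))\<^sup>2)" for S m n r
      by (simp add: h_def sum_nonneg)
    have "L2_set (h i) ?A = sqrt (\<Sum>S\<in>substate_choices d. \<Sum>(m, n, r)\<in>?J. (h i (S, m, n, r))\<^sup>2)"
      unfolding L2_set_def sum.cartesian_product' by (simp only: case_prod_unfold prod.collapse)
    also have "\<dots> \<le> sqrt (?P * (conc_pure d 3 (\<psi>s ! i))\<^sup>2)"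
      unfolding hh using pairs_bound[where d = d and \<psi> = "\<psi>s ! i"] by (rule real_sqrt_le_mono)
    also have "\<dots> = sqrt ?P * conc_pure d 3 (\<psi>s ! i)"
      using nn by (simp only: real_sqrt_mult real_sqrt_abs abs_of_nonneg)
    finally show "L2_set (h i) ?A \<le> sqrt ?P * conc_pure d 3 (\<psi>s ! i)" .
  qed
  also have "\<dots> = sqrt ?P * (\<Sum>\<psi>\<leftarrow>\<psi>s. conc_pure d 3 \<psi>)"
    by (simp only: sum_distrib_left[symmetric]) (simp add: sum_list_sum_nth N_def lessThan_atLeast0)
  finally show ?thesis .
qed

theorem theorem1:
  fixes d :: "nat \<Rightarrow> nat" and \<rho> :: "(nat \<Rightarrow> nat) \<Rightarrow> (nat \<Rightarrow> nat) \<Rightarrow> complex"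
  assumes "d 1 \<ge> 2" and "d 2 \<ge> 2" and "d 3 \<ge> 2"
    and "is_state d 3 \<rho>"
  shows "conc_mixed d 3 \<rho> \<ge>
    1 / sqrt (real ((d 1 - 1) * (d 2 - 1) * (d 3 - 1))) *
    sqrt (\<Sum>S\<in>substate_choices d.
            \<Sum>(m, n)\<in>{(1, 2), (1, 3), (2, 3)}. (Cmn m n (substate S \<rho>))\<^sup>2)"
proof -
  let ?P = "real ((d 1 - 1) * (d 2 - 1) * (d 3 - 1))"
  have P: "sqrt ?P > 0" using assms(1-3) by (simp only: real_sqrt_gt_0_iff of_nat_0_less_iff) simp
  have "\<exists>\<psi>s. is_decomp d 3 \<rho> \<psi>s"
    unfolding is_decomp_def
    by (rule psd_decomposition)
      (use assms(4) in \<open>auto simp: is_state_def psd_op_def Let_def intro: finite_cfg\<close>)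
  \<comment> \<open>Over the reals, a lower bound for all elements bounds \<open>Inf\<close> only if
    the set is nonempty.\<close>
  then have ne: "{(\<Sum>\<psi>\<leftarrow>\<psi>s. conc_pure d 3 \<psi>) | \<psi>s. is_decomp d 3 \<rho> \<psi>s} \<noteq> {}" by blast
  show ?thesis
    unfolding conc_mixed_def
  proof (rule cInf_greatest[OF ne])
    fix c assume "c \<in> {(\<Sum>\<psi>\<leftarrow>\<psi>s. conc_pure d 3 \<psi>) | \<psi>s. is_decomp d 3 \<rho> \<psi>s}"
    then obtain \<psi>s where c: "c = (\<Sum>\<psi>\<leftarrow>\<psi>s. conc_pure d 3 \<psi>)" and dec: "is_decomp d 3 \<rho> \<psi>s" by blast
    define X where "X = sqrt (\<Sum>S\<in>substate_choices d. \<Sum>(m, n)\<in>{(1, 2), (1, 3), (2, 3)}. (Cmn m n (substate S \<rho>))\<^sup>2)"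
    have "X \<le> c * sqrt ?P"
      using sum_conc_pure_ge[OF dec] unfolding X_def c by (simp only: mult.commute)
    then have "X / sqrt ?P \<le> c"
      unfolding pos_divide_le_eq[OF P] .
    then have "1 / sqrt ?P * X \<le> c"
      unfolding times_divide_eq_left mult_1_left .
    then show "1 / sqrt ?P *
      sqrt (\<Sum>S\<in>substate_choices d. \<Sum>(m, n)\<in>{(1, 2), (1, 3), (2, 3)}. (Cmn m n (substate S \<rho>))\<^sup>2) \<le> c"
      unfolding X_def .
  qed
qed


end
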